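(* Let $1\le k\le d$ and $m$ be integers with $d+1-\left\lceil \frac{d+1}{k+1}\right\rceil< m\le d$. Let $X$ be a finite pure $d$-dimensional simplicial complex which is strongly connected with respect to dimension $m$ and satisfies $H_k(X)\neq 0$. Then $X$ has at least $d+1+\left\lceil \frac{m}{k}\right\rceil$ vertices. Moreover, this bound is tight: for such $d,k,m$ there exists a pure $d$-dimensional simplicial complex, strongly connected with respect to dimension $m$, with nontrivial $H_k$ and exactly $d+1+\left\lceil \frac{m}{k}\right\rceil$ vertices.
   Context: A simplicial complex is pure $d$-dimensional if every simplex is contained in a $d$-dimensional face. For a complex $Y$ whose maximal simplices all have dimension $\ge m$, consider the $m$-dimensional faces of its $m$-skeleton and the equivalence relation generated by declaring two $m$-faces related when they share an $(m-1)$-dimensional face; $Y$ is strongly connected with respect to dimension $m$ if all $m$-faces lie in a single equivalence class (equivalently, the maximal faces of $Y$ form a single class under the relation generated by sharing an $(m-1)$-dimensional face). Homology is simplicial homology with coefficients in an arbitrary abelian group. *)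

theory Defs
  imports Complex_Main "HOL-Algebra.Coset" "HOL-Algebra.Elementary_Groups"
begin

text \<open>An abstract simplicial complex is a set of finite nonempty simplices closed under nonempty
  subsets; the empty simplex is not a member. Its vertex set is \<open>\<Union>X\<close>.\<close>

definition simplicial_complex :: "'v set set \<Rightarrow> bool" where
  "simplicial_complex X \<longleftrightarrow>
     (\<forall>\<sigma>\<in>X. finite \<sigma> \<and> \<sigma> \<noteq> {}) \<and> (\<forall>\<sigma>\<in>X. \<forall>\<tau>. \<tau> \<subseteq> \<sigma> \<and> \<tau> \<noteq> {} \<longrightarrow> \<tau> \<in> X)"

definition faces :: "nat \<Rightarrow> 'v set set \<Rightarrow> 'v set set" where
  "faces n X = {\<sigma> \<in> X. card \<sigma> = Suc n}"

definition pure_complex :: "nat \<Rightarrow> 'v set set \<Rightarrow> bool" where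
  "pure_complex d X \<longleftrightarrow> simplicial_complex X \<and> (\<forall>\<sigma>\<in>X. \<exists>\<tau>\<in>faces d X. \<sigma> \<subseteq> \<tau>)"

text \<open>The natural subtraction makes this the relation of sharing an \<open>(m - 1)\<close>-dimensional face
  only for \<open>m \<ge> 1\<close>.\<close>

definition adjacent_faces :: "nat \<Rightarrow> 'v set set \<Rightarrow> 'v set \<Rightarrow> 'v set \<Rightarrow> bool" where
  "adjacent_faces m X \<sigma> \<tau> \<longleftrightarrow>
     \<sigma> \<in> faces m X \<and> \<tau> \<in> faces m X \<and> (\<exists>\<rho>\<in>faces (m - 1) X. \<rho> \<subseteq> \<sigma> \<and> \<rho> \<subseteq> \<tau>)"

definition strongly_connected :: "nat \<Rightarrow> 'v set set \<Rightarrow> bool" where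
  "strongly_connected m X \<longleftrightarrow>
     (\<forall>\<sigma>\<in>faces m X. \<forall>\<tau>\<in>faces m X. equivclp (adjacent_faces m X) \<sigma> \<tau>)"


text \<open>Simplicial homology with coefficients in the abelian group \<open>'g\<close>. Each simplex is oriented by
  the linear order on the vertex type, and the chain \<open>\<Sum>\<sigma>. c \<sigma> \<cdot> \<sigma>\<close> is represented by its coefficient
  function \<open>c\<close>; functions with infinite support occur only if \<open>X\<close> is infinite.\<close>

definition simplicial_chains :: "nat \<Rightarrow> 'v set set \<Rightarrow> ('v set \<Rightarrow> 'g::ab_group_add) set" where
  "simplicial_chains n X = {c. \<forall>\<sigma>. c \<sigma> \<noteq> 0 \<longrightarrow> \<sigma> \<in> faces n X}"

definition incidence :: "'v::linorder \<Rightarrow> 'v set \<Rightarrow> 'g::ab_group_add \<Rightarrow> 'g" where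
  "incidence v \<tau> g = (if even (card {u \<in> \<tau>. u < v}) then g else - g)"

text \<open>For \<open>v\<^sub>0 < \<dots> < v\<^sub>n\<close> the boundary of \<open>{v\<^sub>0, \<dots>, v\<^sub>n}\<close> is the sum over \<open>i\<close> of \<open>(-1)\<^sup>i\<close> times the
  face omitting \<open>v\<^sub>i\<close>. Hence \<open>\<tau>\<close> occurs in the boundaries of the simplices \<open>insert v \<tau>\<close> with \<open>v \<notin> \<tau>\<close>,
  and its sign there is determined by the position of \<open>v\<close>, i.e. the number of vertices of \<open>\<tau>\<close>
  below \<open>v\<close>. Terms with \<open>insert v \<tau> \<notin> X\<close> vanish because \<open>c\<close> is supported on \<open>X\<close>; since the empty
  set is not in \<open>X\<close>, the boundary of a 0-chain is 0.\<close>

definition boundary :: "'v::linorder set set \<Rightarrow> ('v set \<Rightarrow> 'g::ab_group_add) \<Rightarrow> 'v set \<Rightarrow> 'g" where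
  "boundary X c \<tau> =
     (if \<tau> \<in> X then \<Sum>v\<in>\<Union>X - \<tau>. incidence v \<tau> (c (insert v \<tau>)) else 0)"

definition cycles :: "nat \<Rightarrow> 'v::linorder set set \<Rightarrow> ('v set \<Rightarrow> 'g::ab_group_add) set" where
  "cycles n X = {c \<in> simplicial_chains n X. boundary X c = (\<lambda>_. 0)}"

definition boundaries :: "nat \<Rightarrow> 'v::linorder set set \<Rightarrow> ('v set \<Rightarrow> 'g::ab_group_add) set" where
  "boundaries n X = boundary X ` simplicial_chains (Suc n) X"

definition cycle_group ::
    "nat \<Rightarrow> 'v::linorder set set \<Rightarrow> ('v set \<Rightarrow> 'g::ab_group_add) monoid" where
  "cycle_group n X = \<lparr>carrier = cycles n X, monoid.mult = (\<lambda>c c' \<sigma>. c \<sigma> + c' \<sigma>), one = (\<lambda>_. 0)\<rparr>"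

definition homology_group ::
    "nat \<Rightarrow> 'v::linorder set set \<Rightarrow> ('v set \<Rightarrow> 'g::ab_group_add) set monoid" where
  "homology_group n X = cycle_group n X Mod boundaries n X"


lemma incidence_simps [simp]:
  "incidence v \<tau> 0 = 0"
  "incidence v \<tau> (a + b) = incidence v \<tau> a + incidence v \<tau> b"
  "incidence v \<tau> (- a) = - incidence v \<tau> a"
  by (auto simp: incidence_def)

lemma incidence_sum: "incidence v \<tau> (sum f A) = (\<Sum>x\<in>A. incidence v \<tau> (f x))"
  by (induction A rule: infinite_finite_induct) simp_all

lemma boundary_zero: "boundary X (\<lambda>_. 0) = (\<lambda>_. 0)"
  by (auto simp: boundary_def fun_eq_iff)

lemma boundary_add:
  "boundary X (\<lambda>\<sigma>. c \<sigma> + c' \<sigma>) = (\<lambda>\<tau>. boundary X c \<tau> + boundary X c' \<tau>)"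
  by (auto simp: boundary_def fun_eq_iff sum.distrib)

lemma boundary_minus: "boundary X (\<lambda>\<sigma>. - c \<sigma>) = (\<lambda>\<tau>. - boundary X c \<tau>)"
  by (auto simp: boundary_def fun_eq_iff sum_negf)

lemma boundary_in_simplicial_chains:
  assumes X: "simplicial_complex X" and c: "c \<in> simplicial_chains (Suc n) X"
  shows "boundary X c \<in> simplicial_chains n X"
proof -
  have "\<tau> \<in> faces n X" if nz: "boundary X c \<tau> \<noteq> 0" for \<tau>
  proof -
    have tX: "\<tau> \<in> X" and "(\<Sum>v\<in>\<Union>X - \<tau>. incidence v \<tau> (c (insert v \<tau>))) \<noteq> 0"
      using nz by (auto simp: boundary_def split: if_splits)
    then obtain v where "v \<in> \<Union>X - \<tau>" "incidence v \<tau> (c (insert v \<tau>)) \<noteq> 0"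
      by (meson sum.neutral)
    then have "v \<notin> \<tau>" "c (insert v \<tau>) \<noteq> 0" by auto
    then have "insert v \<tau> \<in> faces (Suc n) X" using c by (auto simp: simplicial_chains_def)
    moreover have "finite \<tau>" using X tX by (auto simp: simplicial_complex_def)
    ultimately show ?thesis using tX \<open>v \<notin> \<tau>\<close> by (auto simp: faces_def)
  qed
  then show ?thesis by (auto simp: simplicial_chains_def)
qed

lemma incidence_swap:
  fixes v w :: "'v::linorder"
  assumes "finite \<rho>" "v \<notin> \<rho>" "w \<notin> \<rho>" "v < w"
  shows "incidence w \<rho> (incidence v (insert w \<rho>) g) = - incidence v \<rho> (incidence w (insert v \<rho>) g)"
proof -
  have 1: "{u \<in> insert w \<rho>. u < v} = {u \<in> \<rho>. u < v}" using assms by auto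
  have "{u \<in> insert v \<rho>. u < w} = insert v {u \<in> \<rho>. u < w}" using assms by auto
  then have 2: "card {u \<in> insert v \<rho>. u < w} = Suc (card {u \<in> \<rho>. u < w})" using assms by simp
  show ?thesis unfolding incidence_def 1 2 by simp
qed

lemma boundary_boundary:
  fixes c :: "'v::linorder set \<Rightarrow> 'g::ab_group_add"
  assumes X: "simplicial_complex X" and fin: "finite X" and c: "c \<in> simplicial_chains n X"
  shows "boundary X (boundary X c) = (\<lambda>_. 0)"
proof
  fix \<rho>
  show "boundary X (boundary X c) \<rho> = 0"
  proof (cases "\<rho> \<in> X")
    case False
    then show ?thesis by (simp add: boundary_def)
  next
    case True
    define V where "V = \<Union>X - \<rho>"
    have fin_simplex: "finite \<sigma>" if "\<sigma> \<in> X" for \<sigma>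
      using X that unfolding simplicial_complex_def by blast
    have f\<rho>: "finite \<rho>" using True by (rule fin_simplex)
    have fV: "finite V" unfolding V_def using fin fin_simplex by (intro finite_Diff finite_Union)
    define F where "F v w = incidence v \<rho> (incidence w (insert v \<rho>) (c (insert w (insert v \<rho>))))" for v w
    have inner: "boundary X c (insert v \<rho>) =
        (\<Sum>w\<in>V - {v}. incidence w (insert v \<rho>) (c (insert w (insert v \<rho>))))" for v
    proof (cases "insert v \<rho> \<in> X")
      case True
      then show ?thesis by (simp add: boundary_def V_def Diff_insert[symmetric])
    next
      case False
      have "c (insert w (insert v \<rho>)) = 0" for w
      proof (rule ccontr)
        assume "c (insert w (insert v \<rho>)) \<noteq> 0"
        then have "insert w (insert v \<rho>) \<in> X" using c by (auto simp: simplicial_chains_def faces_def)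
        then have "insert v \<rho> \<in> X" using X unfolding simplicial_complex_def
          by (metis insert_not_empty subset_insertI)
        with False show False by simp
      qed
      with False show ?thesis by (simp add: boundary_def)
    qed
    have "boundary X (boundary X c) \<rho> = (\<Sum>v\<in>V. \<Sum>w\<in>V - {v}. F v w)"
      using True by (simp add: boundary_def[of X "boundary X c"] inner F_def incidence_sum V_def)
    also have "\<dots> = (\<Sum>v\<in>V. (\<Sum>w\<in>{w\<in>V. v < w}. F v w) + (\<Sum>w\<in>{w\<in>V. w < v}. F v w))"
    proof (rule sum.cong[OF refl])
      fix v
      have "V - {v} = {w\<in>V. v < w} \<union> {w\<in>V. w < v}" by auto
      moreover have "{w\<in>V. v < w} \<inter> {w\<in>V. w < v} = {}" by auto
      ultimately show "(\<Sum>w\<in>V - {v}. F v w) = (\<Sum>w\<in>{w\<in>V. v < w}. F v w) + (\<Sum>w\<in>{w\<in>V. w < v}. F v w)"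
        using fV by (simp add: sum.union_disjoint)
    qed
    also have "\<dots> = (\<Sum>v\<in>V. \<Sum>w\<in>{w\<in>V. v < w}. F v w) + (\<Sum>v\<in>V. \<Sum>w\<in>{w\<in>V. w < v}. F v w)"
      by (rule sum.distrib)
    also have "(\<Sum>v\<in>V. \<Sum>w\<in>{w\<in>V. w < v}. F v w) = (\<Sum>v\<in>V. \<Sum>w\<in>{w\<in>V. v < w}. F w v)"
      using fV by (rule sum.swap_restrict) (rule fV)
    also have "\<dots> = (\<Sum>v\<in>V. \<Sum>w\<in>{w\<in>V. v < w}. - F v w)"
    proof (intro sum.cong refl)
      fix v w assume "v \<in> V" "w \<in> {w\<in>V. v < w}"
      then show "F w v = - F v w"
        using incidence_swap[OF f\<rho>, of v w] by (simp add: F_def V_def insert_commute)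
    qed
    finally show ?thesis by (simp add: sum_negf)
  qed
qed

lemma simplicial_chains_add:
  assumes "c \<in> simplicial_chains n X" "c' \<in> simplicial_chains n X"
  shows "(\<lambda>\<sigma>. c \<sigma> + c' \<sigma>) \<in> simplicial_chains n X"
  unfolding simplicial_chains_def
proof (intro CollectI allI impI)
  fix \<sigma> assume "c \<sigma> + c' \<sigma> \<noteq> 0"
  then have "c \<sigma> \<noteq> 0 \<or> c' \<sigma> \<noteq> 0" by auto
  then show "\<sigma> \<in> faces n X" using assms by (auto simp: simplicial_chains_def)
qed

lemma simplicial_chains_minus: "c \<in> simplicial_chains n X \<Longrightarrow> (\<lambda>\<sigma>. - c \<sigma>) \<in> simplicial_chains n X"
  by (simp add: simplicial_chains_def)

lemma comm_group_cycle_group: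
  "comm_group (cycle_group n X :: ('v::linorder set \<Rightarrow> 'g::ab_group_add) monoid)"
proof (rule comm_groupI)
  fix c c' :: "'v set \<Rightarrow> 'g"
  assume "c \<in> carrier (cycle_group n X)" "c' \<in> carrier (cycle_group n X)"
  then show "c \<otimes>\<^bsub>cycle_group n X\<^esub> c' \<in> carrier (cycle_group n X)"
    by (simp add: cycle_group_def cycles_def simplicial_chains_add boundary_add)
next
  show "\<one>\<^bsub>cycle_group n X\<^esub> \<in> carrier (cycle_group n X)"
    by (simp add: cycle_group_def cycles_def simplicial_chains_def boundary_zero)
next
  fix c :: "'v set \<Rightarrow> 'g"
  assume "c \<in> carrier (cycle_group n X)"
  then have "(\<lambda>\<sigma>. - c \<sigma>) \<in> carrier (cycle_group n X)"
    by (simp add: cycle_group_def cycles_def simplicial_chains_minus boundary_minus)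
  then show "\<exists>c'\<in>carrier (cycle_group n X). c' \<otimes>\<^bsub>cycle_group n X\<^esub> c = \<one>\<^bsub>cycle_group n X\<^esub>"
    by (rule bexI[rotated]) (simp add: cycle_group_def)
qed (simp_all add: cycle_group_def ac_simps)

lemma subgroup_boundaries:
  assumes X: "simplicial_complex X" "finite X"
  shows "subgroup (boundaries n X :: ('v::linorder set \<Rightarrow> 'g::ab_group_add) set) (cycle_group n X)"
proof (rule group.subgroupI)
  show "group (cycle_group n X)" using comm_group_cycle_group by (rule comm_group.axioms(2))
  show sub: "boundaries n X \<subseteq> carrier (cycle_group n X)"
    unfolding boundaries_def cycle_group_def cycles_def
    using boundary_in_simplicial_chains[OF X(1)] boundary_boundary[OF X] by auto
  show "boundaries n X \<noteq> {}" by (auto simp: boundaries_def simplicial_chains_def)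
  fix b :: "'v set \<Rightarrow> 'g" assume b: "b \<in> boundaries n X"
  then obtain c where c: "c \<in> simplicial_chains (Suc n) X" "b = boundary X c" by (auto simp: boundaries_def)
  have mem: "(\<lambda>\<sigma>. - b \<sigma>) \<in> boundaries n X"
    unfolding boundaries_def using c
    by (intro image_eqI[of _ _ "\<lambda>\<sigma>. - c \<sigma>"]) (simp_all add: simplicial_chains_minus boundary_minus)
  have "inv\<^bsub>cycle_group n X\<^esub> b = (\<lambda>\<sigma>. - b \<sigma>)"
    by (rule group.inv_equality[OF comm_group.axioms(2)[OF comm_group_cycle_group]])
      (use sub b mem in \<open>auto simp: cycle_group_def\<close>)
  then show "inv\<^bsub>cycle_group n X\<^esub> b \<in> boundaries n X" using mem by simp
  fix b' :: "'v set \<Rightarrow> 'g" assume "b' \<in> boundaries n X"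
  then obtain c' where c': "c' \<in> simplicial_chains (Suc n) X" "b' = boundary X c'" by (auto simp: boundaries_def)
  have "(\<lambda>\<sigma>. c \<sigma> + c' \<sigma>) \<in> simplicial_chains (Suc n) X"
    using c c' by (simp add: simplicial_chains_add)
  then show "b \<otimes>\<^bsub>cycle_group n X\<^esub> b' \<in> boundaries n X"
    using c c' by (auto simp: cycle_group_def boundaries_def boundary_add[symmetric])
qed

lemma group_homology_group:
  assumes "simplicial_complex X" "finite X"
  shows "group (homology_group n X)"
  unfolding homology_group_def
  by (intro normal.factorgroup_is_group comm_group.subgroup_imp_normal
      comm_group_cycle_group subgroup_boundaries assms)

end

theory Submission
  imports Defs
begin

text \<open>Lower bound: let \<open>X\<close> have \<open>d + 1 + c\<close> vertices and suppose \<open>k c < m\<close>. Every facet misses \<open>c\<close>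
  vertices, so any \<open>k + 1\<close> facets have a common vertex, and so do any \<open>k + 2\<close> facets two of which share
  \<open>m\<close> vertices. By strong connectivity the facets can be listed so that each shares \<open>m\<close> vertices
  with an earlier one. Adding them in this order, Mayer-Vietoris reduces \<open>H\<^sub>k = 0\<close> to the vanishing of
  \<open>H\<^sub>k\<^sub>-\<^sub>1\<close> of the intersection of the new facet with the previous ones, which is covered by
  simplices with the same properties for \<open>k - 1\<close>.

  Tightness: let \<open>c = \<lceil>m / k\<rceil>\<close>, take disjoint vertex sets \<open>W\<close> of size \<open>m + c\<close> and \<open>A\<close> of size
  \<open>d + 1 - m\<close>, and cover \<open>W\<close> irredundantly by sets \<open>E\<^sub>0, \<dots>, E\<^sub>k\<close> of size \<open>c\<close>. The \<open>d\<close>-skeleton of the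
  simplex on \<open>W\<close> together with the simplices \<open>(A \<union> W) - E\<^sub>j\<close> retracts to the boundary of a
  \<open>(k + 1)\<close>-simplex.\<close>

section \<open>Mayer-Vietoris for unions of simplices\<close>

text \<open>As \<open>{} \<in> Pow V\<close>, \<open>boundary (Pow V)\<close> is the augmented boundary on \<open>V\<close>; degrees are counted by the
  number \<open>q\<close> of vertices, so that \<open>exact_at V q K\<close> is the vanishing of reduced homology in
  dimension \<open>q - 1\<close>.\<close>

definition aug_chains :: "nat \<Rightarrow> 'v set set \<Rightarrow> ('v set \<Rightarrow> 'g::ab_group_add) set" where
  "aug_chains q K = {c. \<forall>\<sigma>. c \<sigma> \<noteq> 0 \<longrightarrow> \<sigma> \<in> K \<and> card \<sigma> = q}"

definition exact_at :: "'v::linorder set \<Rightarrow> nat \<Rightarrow> 'v set set \<Rightarrow> 'g::ab_group_add itself \<Rightarrow> bool" where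
  "exact_at V q K (_ :: 'g itself) \<longleftrightarrow>
     (\<forall>c\<in>aug_chains q K. boundary (Pow V) c = (\<lambda>_. 0) \<longrightarrow>
        (\<exists>b\<in>aug_chains (Suc q) K. boundary (Pow V) b = (c :: 'v set \<Rightarrow> 'g)))"

lemma aug_chainsI: "(\<And>\<sigma>. c \<sigma> \<noteq> 0 \<Longrightarrow> \<sigma> \<in> K \<and> card \<sigma> = q) \<Longrightarrow> c \<in> aug_chains q K"
  by (simp add: aug_chains_def)

lemma aug_chainsD:
  assumes "c \<in> aug_chains q K" "c \<sigma> \<noteq> 0"
  shows "\<sigma> \<in> K" "card \<sigma> = q"
  using assms by (auto simp: aug_chains_def)

lemma aug_chains_add:
  "c \<in> aug_chains q K \<Longrightarrow> c' \<in> aug_chains q K \<Longrightarrow> (\<lambda>\<sigma>. c \<sigma> + c' \<sigma>) \<in> aug_chains q K"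
  by (rule aug_chainsI) (metis aug_chainsD add_0)

lemma aug_chains_minus: "c \<in> aug_chains q K \<Longrightarrow> (\<lambda>\<sigma>. - c \<sigma>) \<in> aug_chains q K"
  by (simp add: aug_chains_def)

lemma aug_chains_mono: "c \<in> aug_chains q K \<Longrightarrow> K \<subseteq> L \<Longrightarrow> c \<in> aug_chains q L"
  by (auto simp: aug_chains_def)

lemma boundary_Pow:
  "\<tau> \<subseteq> V \<Longrightarrow> boundary (Pow V) c \<tau> = (\<Sum>v\<in>V - \<tau>. incidence v \<tau> (c (insert v \<tau>)))"
  by (simp add: boundary_def)

lemma incidence_involution [simp]: "incidence v \<tau> (incidence v \<tau> g) = g"
  by (simp add: incidence_def)

text \<open>Needed besides \<open>boundary_boundary\<close> because \<open>Pow V\<close> contains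
  \<open>{}\<close> and so is no \<open>simplicial_complex\<close>. The terms for
  \<open>(v, w)\<close> and \<open>(w, v)\<close> cancel as before.\<close>

lemma boundary_Pow_boundary:
  assumes "finite V"
  shows "boundary (Pow V) (boundary (Pow V) c) = (\<lambda>_. 0)"
proof
  fix \<rho>
  show "boundary (Pow V) (boundary (Pow V) c) \<rho> = 0"
  proof (cases "\<rho> \<subseteq> V")
    case False
    then show ?thesis by (simp add: boundary_def)
  next
    case True
    define U where "U = V - \<rho>"
    have f\<rho>: "finite \<rho>" using True assms by (rule finite_subset)
    have fU: "finite U" using assms by (simp add: U_def)
    define F where "F v w = incidence v \<rho> (incidence w (insert v \<rho>) (c (insert w (insert v \<rho>))))" for v w
    have "boundary (Pow V) (boundary (Pow V) c) \<rho> = (\<Sum>v\<in>U. \<Sum>w\<in>U - {v}. F v w)"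
      unfolding boundary_Pow[OF True] U_def[symmetric]
    proof (rule sum.cong[OF refl])
      fix v assume "v \<in> U"
      then have "insert v \<rho> \<subseteq> V" using True by (auto simp: U_def)
      moreover have "V - insert v \<rho> = U - {v}" by (auto simp: U_def)
      ultimately show "incidence v \<rho> (boundary (Pow V) c (insert v \<rho>)) = (\<Sum>w\<in>U - {v}. F v w)"
        by (simp add: boundary_Pow incidence_sum F_def)
    qed
    also have "\<dots> = (\<Sum>v\<in>U. (\<Sum>w\<in>{w\<in>U. v < w}. F v w) + (\<Sum>w\<in>{w\<in>U. w < v}. F v w))"
    proof (rule sum.cong[OF refl])
      fix v
      have "U - {v} = {w\<in>U. v < w} \<union> {w\<in>U. w < v}" by auto
      moreover have "{w\<in>U. v < w} \<inter> {w\<in>U. w < v} = {}" by auto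
      ultimately show "(\<Sum>w\<in>U - {v}. F v w) = (\<Sum>w\<in>{w\<in>U. v < w}. F v w) + (\<Sum>w\<in>{w\<in>U. w < v}. F v w)"
        using fU by (simp add: sum.union_disjoint)
    qed
    also have "\<dots> = (\<Sum>v\<in>U. \<Sum>w\<in>{w\<in>U. v < w}. F v w) + (\<Sum>v\<in>U. \<Sum>w\<in>{w\<in>U. w < v}. F v w)"
      by (rule sum.distrib)
    also have "(\<Sum>v\<in>U. \<Sum>w\<in>{w\<in>U. w < v}. F v w) = (\<Sum>v\<in>U. \<Sum>w\<in>{w\<in>U. v < w}. F w v)"
      using fU by (rule sum.swap_restrict) (rule fU)
    also have "\<dots> = (\<Sum>v\<in>U. \<Sum>w\<in>{w\<in>U. v < w}. - F v w)"
    proof (intro sum.cong refl)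
      fix v w assume "v \<in> U" "w \<in> {w\<in>U. v < w}"
      then show "F w v = - F v w"
        using incidence_swap[OF f\<rho>, of v w] by (simp add: F_def U_def insert_commute)
    qed
    finally show ?thesis by (simp add: sum_negf)
  qed
qed

lemma boundary_in_aug_chains:
  assumes "finite V" "K \<subseteq> Pow V" and down: "\<And>\<sigma> \<tau>. \<sigma> \<in> K \<Longrightarrow> \<tau> \<subseteq> \<sigma> \<Longrightarrow> \<tau> \<in> K"
    and c: "c \<in> aug_chains (Suc q) K"
  shows "boundary (Pow V) c \<in> aug_chains q K"
proof (rule aug_chainsI)
  fix \<tau> assume nz: "boundary (Pow V) c \<tau> \<noteq> 0"
  then have \<tau>: "\<tau> \<subseteq> V" by (auto simp: boundary_def split: if_splits)
  then obtain v where v: "v \<in> V - \<tau>" "incidence v \<tau> (c (insert v \<tau>)) \<noteq> 0"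
    using nz by (metis (no_types, lifting) boundary_Pow sum.neutral)
  then have "c (insert v \<tau>) \<noteq> 0" by auto
  from aug_chainsD[OF c this] have "insert v \<tau> \<in> K" "card (insert v \<tau>) = Suc q" .
  moreover have "finite \<tau>" using \<tau> assms(1) by (rule finite_subset)
  ultimately show "\<tau> \<in> K \<and> card \<tau> = q" using v down by auto
qed

text \<open>A cycle on the union is cut into a chain on each side. The boundary of the cut lies in
  the intersection, one degree lower; filling it there corrects both pieces to cycles.\<close>

lemma exact_at_union:
  fixes K L :: "'v::linorder set set"
  assumes V: "finite V" "K \<subseteq> Pow V" "L \<subseteq> Pow V"
    and downK: "\<And>\<sigma> \<tau>. \<sigma> \<in> K \<Longrightarrow> \<tau> \<subseteq> \<sigma> \<Longrightarrow> \<tau> \<in> K"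
    and downL: "\<And>\<sigma> \<tau>. \<sigma> \<in> L \<Longrightarrow> \<tau> \<subseteq> \<sigma> \<Longrightarrow> \<tau> \<in> L"
    and K: "exact_at V (Suc q) K TYPE('g::ab_group_add)"
    and L: "exact_at V (Suc q) L TYPE('g)"
    and KL: "exact_at V q (K \<inter> L) TYPE('g)"
  shows "exact_at V (Suc q) (K \<union> L) TYPE('g)"
  unfolding exact_at_def
proof (intro ballI impI)
  fix c :: "'v set \<Rightarrow> 'g"
  let ?d = "boundary (Pow V)"
  assume c: "c \<in> aug_chains (Suc q) (K \<union> L)" and cyc: "?d c = (\<lambda>_. 0)"
  define c1 where "c1 = (\<lambda>\<sigma>. if \<sigma> \<in> K then c \<sigma> else 0)"
  define c2 where "c2 = (\<lambda>\<sigma>. if \<sigma> \<in> K then 0 else c \<sigma>)"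
  have c1: "c1 \<in> aug_chains (Suc q) K" and c2: "c2 \<in> aug_chains (Suc q) L"
    using c by (auto simp: aug_chains_def c1_def c2_def)
  have split: "c = (\<lambda>\<sigma>. c1 \<sigma> + c2 \<sigma>)" by (auto simp: c1_def c2_def)
  have d2: "?d c2 = (\<lambda>\<tau>. - ?d c1 \<tau>)"
  proof
    fix \<tau>
    have "?d c1 \<tau> + ?d c2 \<tau> = 0" using cyc unfolding split boundary_add by meson
    then show "?d c2 \<tau> = - ?d c1 \<tau>" by (simp add: eq_neg_iff_add_eq_0 add.commute)
  qed
  have "?d c1 \<in> aug_chains q K" by (rule boundary_in_aug_chains[OF V(1,2) downK c1])
  moreover have "?d c2 \<in> aug_chains q L" by (rule boundary_in_aug_chains[OF V(1,3) downL c2])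
  \<comment> \<open>As \<open>?d c1\<close> and \<open>?d c2\<close> differ only in sign, the
    support lies in both complexes.\<close>
  ultimately have "?d c1 \<in> aug_chains q (K \<inter> L)" unfolding d2 aug_chains_def by auto
  then obtain e where e: "e \<in> aug_chains (Suc q) (K \<inter> L)" "?d e = ?d c1"
    using KL boundary_Pow_boundary[OF V(1)] unfolding exact_at_def by blast
  have eK: "e \<in> aug_chains (Suc q) K" and eL: "e \<in> aug_chains (Suc q) L"
    using e(1) by (auto intro: aug_chains_mono)
  have "?d (\<lambda>\<sigma>. c1 \<sigma> + - e \<sigma>) = (\<lambda>_. 0)"
    unfolding boundary_add boundary_minus e(2) by simp
  then obtain b1 where b1: "b1 \<in> aug_chains (Suc (Suc q)) K" "?d b1 = (\<lambda>\<sigma>. c1 \<sigma> + - e \<sigma>)"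
    using K aug_chains_add[OF c1 aug_chains_minus[OF eK]] unfolding exact_at_def by blast
  have "?d (\<lambda>\<sigma>. c2 \<sigma> + e \<sigma>) = (\<lambda>_. 0)"
    unfolding boundary_add d2 e(2) by simp
  then obtain b2 where b2: "b2 \<in> aug_chains (Suc (Suc q)) L" "?d b2 = (\<lambda>\<sigma>. c2 \<sigma> + e \<sigma>)"
    using L aug_chains_add[OF c2 eL] unfolding exact_at_def by blast
  show "\<exists>b\<in>aug_chains (Suc (Suc q)) (K \<union> L). ?d b = c"
  proof
    show "?d (\<lambda>\<sigma>. b1 \<sigma> + b2 \<sigma>) = c" unfolding boundary_add b1 b2 split by auto
    show "(\<lambda>\<sigma>. b1 \<sigma> + b2 \<sigma>) \<in> aug_chains (Suc (Suc q)) (K \<union> L)"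
      using b1(1) b2(1) by (intro aug_chains_add) (auto intro: aug_chains_mono)
  qed
qed

section \<open>Cones and the acyclicity of a simplex\<close>

lemma incidence_insert:
  assumes "finite \<rho>" "x \<notin> \<rho>"
  shows "incidence y (insert x \<rho>) g = (if x < y then - incidence y \<rho> g else incidence y \<rho> g)"
proof (cases "x < y")
  case True
  then have "{u \<in> insert x \<rho>. u < y} = insert x {u \<in> \<rho>. u < y}" by auto
  then show ?thesis using assms True by (simp add: incidence_def)
next
  case False
  then have "{u \<in> insert x \<rho>. u < y} = {u \<in> \<rho>. u < y}" by auto
  then show ?thesis using False by (simp add: incidence_def)
qed

text \<open>The sign rule behind the cone homotopy: passing to the face without \<open>v\<close> and
  coning from \<open>a\<close> anticommute.\<close>

lemma incidence_cone:
  fixes a v :: "'v::linorder"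
  assumes "finite \<rho>" "a \<notin> \<rho>" "v \<notin> \<rho>" "a \<noteq> v"
  shows "incidence v (insert a \<rho>) (incidence a (insert v \<rho>) g) = - incidence a \<rho> (incidence v \<rho> g)"
  using assms by (auto simp: incidence_insert) (auto simp: incidence_def)

text \<open>Coning from a vertex of \<open>F\<close> fills every cycle. For \<open>F = {}\<close>
  the nonzero multiples of the empty simplex would be cycles at \<open>q = 0\<close> that nothing
  fills.\<close>

lemma exact_at_simplex:
  fixes F :: "'v::linorder set"
  assumes V: "finite V" "F \<subseteq> V" and "F \<noteq> {}"
  shows "exact_at V q (Pow F) TYPE('g::ab_group_add)"
  unfolding exact_at_def
proof (intro ballI impI)
  fix c :: "'v set \<Rightarrow> 'g"
  assume c: "c \<in> aug_chains q (Pow F)" and cyc: "boundary (Pow V) c = (\<lambda>_. 0)"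
  from \<open>F \<noteq> {}\<close> obtain a where a: "a \<in> F" by auto
  then have aV: "a \<in> V" using V by auto
  \<comment> \<open>The cone over the part of \<open>c\<close> avoiding \<open>a\<close>, signed so
    that the face opposite \<open>a\<close> gives back \<open>c\<close>.\<close>
  define b where "b = (\<lambda>\<sigma>. if a \<in> \<sigma> then incidence a (\<sigma> - {a}) (c (\<sigma> - {a})) else 0)"
  have "b \<in> aug_chains (Suc q) (Pow F)"
  proof (rule aug_chainsI)
    fix \<sigma> assume "b \<sigma> \<noteq> 0"
    then have as: "a \<in> \<sigma>" and "c (\<sigma> - {a}) \<noteq> 0" by (auto simp: b_def split: if_splits)
    from aug_chainsD[OF c this(2)] have *: "\<sigma> - {a} \<subseteq> F" "card (\<sigma> - {a}) = q" by auto
    then have "finite (\<sigma> - {a})" using V finite_subset by metis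
    then have "card \<sigma> = Suc q" using * as by (metis card.remove finite_Diff_insert finite_Diff2 finite.emptyI)
    then show "\<sigma> \<in> Pow F \<and> card \<sigma> = Suc q" using * a by auto
  qed
  moreover have "boundary (Pow V) b = c"
  proof
    fix \<tau>
    show "boundary (Pow V) b \<tau> = c \<tau>"
    proof (cases "\<tau> \<subseteq> V")
      case False
      then have "c \<tau> = 0" using aug_chainsD(1)[OF c, of \<tau>] V by auto
      then show ?thesis using False by (simp add: boundary_def)
    next
      case \<tau>: True
      have fin: "finite \<tau>" using \<tau> V finite_subset by auto
      show ?thesis
      proof (cases "a \<in> \<tau>")
        case False
        \<comment> \<open>Only \<open>v = a\<close> contributes, as \<open>b\<close> vanishes on
          simplices without \<open>a\<close>.\<close>
        have "boundary (Pow V) b \<tau> = (\<Sum>v\<in>V - \<tau>. if v = a then c \<tau> else 0)"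
          unfolding boundary_Pow[OF \<tau>] using False
          by (intro sum.cong) (auto simp: b_def)
        then show ?thesis using False aV V by simp
      next
        case True
        define \<rho> where "\<rho> = \<tau> - {a}"
        have \<tau>_eq: "\<tau> = insert a \<rho>" and a\<rho>: "a \<notin> \<rho>" and \<rho>V: "\<rho> \<subseteq> V" and fr: "finite \<rho>"
          using True \<tau> fin by (auto simp: \<rho>_def)
        have "boundary (Pow V) b \<tau> = (\<Sum>v\<in>V - \<tau>. - incidence a \<rho> (incidence v \<rho> (c (insert v \<rho>))))"
          unfolding boundary_Pow[OF \<tau>]
        proof (rule sum.cong[OF refl])
          fix v assume v: "v \<in> V - \<tau>"
          then have "insert v \<tau> - {a} = insert v \<rho>" using True by (auto simp: \<rho>_def)
          then show "incidence v \<tau> (b (insert v \<tau>)) = - incidence a \<rho> (incidence v \<rho> (c (insert v \<rho>)))"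
            using incidence_cone[OF fr a\<rho>, of v] v by (auto simp: b_def \<tau>_eq)
        qed
        also have "\<dots> = - incidence a \<rho> (\<Sum>v\<in>V - \<tau>. incidence v \<rho> (c (insert v \<rho>)))"
          by (simp add: sum_negf incidence_sum)
        \<comment> \<open>The cycle condition at \<open>\<rho>\<close>, with the term
          \<open>v = a\<close> split off.\<close>
        also have "(\<Sum>v\<in>V - \<tau>. incidence v \<rho> (c (insert v \<rho>))) = - incidence a \<rho> (c \<tau>)"
        proof -
          have "V - \<rho> - {a} = V - \<tau>" using \<tau>_eq by auto
          then have "boundary (Pow V) c \<rho>
              = incidence a \<rho> (c \<tau>) + (\<Sum>v\<in>V - \<tau>. incidence v \<rho> (c (insert v \<rho>)))"
            unfolding boundary_Pow[OF \<rho>V]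
            using sum.remove[of "V - \<rho>" a "\<lambda>v. incidence v \<rho> (c (insert v \<rho>))"] V(1) aV a\<rho>
            by (metis DiffI \<tau>_eq finite_Diff)
          then show ?thesis using cyc by (simp add: eq_neg_iff_add_eq_0 add.commute)
        qed
        finally show ?thesis by simp
      qed
    qed
  qed
  ultimately show "\<exists>b\<in>aug_chains (Suc q) (Pow F). boundary (Pow V) b = c" by blast
qed

text \<open>The list grows at its head: its last element is the start, and each new head is related
  to some element already in the tail.\<close>

fun linked :: "('a \<Rightarrow> 'a \<Rightarrow> bool) \<Rightarrow> 'a list \<Rightarrow> bool" where
  "linked R [] = True"
| "linked R (x # xs) = (linked R xs \<and> (xs \<noteq> [] \<longrightarrow> (\<exists>y\<in>set xs. R y x)))"

lemma linked_map:
  assumes "linked R xs" "\<And>x y. R x y \<Longrightarrow> S (f x) (f y)"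
  shows "linked S (map f xs)"
  using assms by (induction xs) auto

lemma linked_mono:
  assumes "linked R xs" "\<And>x y. R x y \<Longrightarrow> S x y"
  shows "linked S xs"
  using linked_map[of R xs S id] assms by simp

text \<open>As long as the list misses an element of \<open>D\<close>, a path from \<open>a\<close>
  to that element has to leave the list; the endpoint of the leaving step becomes the new
  head.\<close>

lemma linked_enumeration:
  assumes "finite D" and conn: "\<And>x y. x \<in> D \<Longrightarrow> y \<in> D \<Longrightarrow> R\<^sup>*\<^sup>* x y"
    and RD: "\<And>x y. R x y \<Longrightarrow> y \<in> D"
  shows "\<exists>xs. set xs = D \<and> linked R xs"
proof (cases "D = {}")
  case True
  then show ?thesis by (intro exI[of _ "[]"]) auto
next
  case False
  then obtain a where a: "a \<in> D" by auto
  have "\<exists>xs. a \<in> set xs \<and> set xs \<subseteq> D \<and> linked R xs \<and> card (set xs) = Suc i" if "Suc i \<le> card D" for i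
    using that
  proof (induction i)
    case 0
    show ?case using a by (intro exI[of _ "[a]"]) auto
  next
    case (Suc i)
    then obtain xs where xs: "a \<in> set xs" "set xs \<subseteq> D" "linked R xs" "card (set xs) = Suc i" by auto
    then have "set xs \<noteq> D" using Suc.prems by auto
    then obtain y where y: "y \<in> D" "y \<notin> set xs" using xs by auto
    have "\<exists>u\<in>set xs. \<exists>v. v \<notin> set xs \<and> R u v"
    proof (rule ccontr)
      assume none: "\<not> ?thesis"
      have "R\<^sup>*\<^sup>* a z \<Longrightarrow> z \<in> set xs" for z
        by (induction rule: rtranclp_induct) (use xs none in auto)
      then show False using conn[OF a y(1)] y by blast
    qed
    then obtain u v where uv: "u \<in> set xs" "v \<notin> set xs" "R u v" by blast
    then show ?case using xs RD by (intro exI[of _ "v # xs"]) auto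
  qed
  from this[of "card D - 1"] obtain xs where "set xs \<subseteq> D" "linked R xs" "card (set xs) = card D"
    using assms(1) False by (metis Suc_diff_1 card_gt_0_iff order_refl)
  then show ?thesis using assms(1) card_subset_eq by blast
qed

text \<open>Double induction on \<open>q\<close> and the list. The head \<open>F\<close> meets the
  union of the others in the simplices \<open>G \<inter> F\<close>. Since \<open>F\<close> takes
  part in every intersection of these, they satisfy both meeting hypotheses for
  \<open>q - 1\<close>, and \<open>exact_at_union\<close> applies.\<close>

lemma exact_at_linked_union:
  fixes Fs :: "'v::linorder set list"
  assumes V: "finite V" and "\<And>F. F \<in> set Fs \<Longrightarrow> F \<subseteq> V"
    and "\<exists>F\<in>set Fs. F \<noteq> {}"
    and "\<And>T. T \<subseteq> set Fs \<Longrightarrow> T \<noteq> {} \<Longrightarrow> card T \<le> q \<Longrightarrow> \<Inter>T \<noteq> {}"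
    and "linked (\<lambda>G H. \<forall>T. T \<subseteq> set Fs \<longrightarrow> card T < q \<longrightarrow> G \<inter> H \<inter> \<Inter>T \<noteq> {}) Fs"
  shows "exact_at V q (\<Union>F\<in>set Fs. Pow F) TYPE('g::ab_group_add)"
  using assms(2-)
proof (induction q arbitrary: Fs)
  case 0
  \<comment> \<open>The only simplex with 0 vertices is \<open>{}\<close>, so the cycle already lies
    in a single nonempty simplex.\<close>
  then obtain F where F: "F \<in> set Fs" "F \<noteq> {}" by auto
  then have ex: "exact_at V 0 (Pow F) TYPE('g)" by (intro exact_at_simplex V 0(1))
  show ?case
    unfolding exact_at_def
  proof (intro ballI impI)
    fix c :: "'v set \<Rightarrow> 'g"
    assume c: "c \<in> aug_chains 0 (\<Union>F\<in>set Fs. Pow F)" and cyc: "boundary (Pow V) c = (\<lambda>_. 0)"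
    have "c \<in> aug_chains 0 (Pow F)"
    proof (rule aug_chainsI)
      fix \<sigma> assume "c \<sigma> \<noteq> 0"
      from aug_chainsD[OF c this] have "\<sigma> \<subseteq> V" "card \<sigma> = 0" using 0(1) by auto
      then show "\<sigma> \<in> Pow F \<and> card \<sigma> = 0" using finite_subset[OF _ V] by auto
    qed
    then obtain b where "b \<in> aug_chains (Suc 0) (Pow F)" "boundary (Pow V) b = c"
      using ex cyc unfolding exact_at_def by blast
    then show "\<exists>b\<in>aug_chains (Suc 0) (\<Union>F\<in>set Fs. Pow F). boundary (Pow V) b = c"
      using F by (intro bexI[of _ b]) (auto intro: aug_chains_mono)
  qed
next
  case (Suc q)
  note outer = Suc.IH
  from Suc.prems show ?case
  proof (induction Fs)
    case Nil
    then show ?case by simp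
  next
    case (Cons F Fs)
    note sub = Cons.prems(1) and meet = Cons.prems(3) and lnk = Cons.prems(4)
    have ne: "G \<noteq> {}" if "G \<in> set (F # Fs)" for G
      using meet[of "{G}"] that by auto
    have simplex: "exact_at V (Suc q) (Pow F) TYPE('g)"
      by (intro exact_at_simplex V sub ne) auto
    show ?case
    proof (cases "Fs = []")
      case True
      then show ?thesis using simplex by simp
    next
      case False
      let ?R = "\<lambda>G H. \<forall>T. T \<subseteq> set (F # Fs) \<longrightarrow> card T < Suc q \<longrightarrow> G \<inter> H \<inter> \<Inter>T \<noteq> {}"
      let ?As = "map (\<lambda>G. G \<inter> F) Fs"
      have lnk': "linked ?R Fs" and par: "\<exists>G\<in>set Fs. ?R G F" using lnk False by auto
      have rest: "exact_at V (Suc q) (\<Union>F\<in>set Fs. Pow F) TYPE('g)"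
      proof (rule Cons.IH)
        show "\<And>G. G \<in> set Fs \<Longrightarrow> G \<subseteq> V" using sub by auto
        show "\<exists>G\<in>set Fs. G \<noteq> {}" using ne False by (cases Fs) auto
        show "\<And>T. T \<subseteq> set Fs \<Longrightarrow> T \<noteq> {} \<Longrightarrow> card T \<le> Suc q \<Longrightarrow> \<Inter>T \<noteq> {}"
          using meet by (meson set_subset_Cons subset_trans)
        show "linked (\<lambda>G H. \<forall>T. T \<subseteq> set Fs \<longrightarrow> card T < Suc q \<longrightarrow> G \<inter> H \<inter> \<Inter>T \<noteq> {}) Fs"
          by (rule linked_mono[OF lnk']) (meson set_subset_Cons subset_trans)
      qed
      \<comment> \<open>A family of traces on \<open>F\<close> comes from equally many members of
        the list, one chosen for each trace; together with \<open>F\<close> this is at most one set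
        more.\<close>
      have lift: "\<exists>T'\<subseteq>set (F # Fs). card T' \<le> Suc (card T) \<and> F \<in> T' \<and> \<Inter>T' = F \<inter> \<Inter>T"
        if T: "T \<subseteq> set ?As" for T
      proof -
        obtain T0 where T0: "T0 \<subseteq> set Fs" "inj_on (\<lambda>G. G \<inter> F) T0" "T = (\<lambda>G. G \<inter> F) ` T0"
          using T by (metis subset_image_inj set_map)
        then have "card T = card T0" by (simp add: card_image)
        then have "card (insert F T0) \<le> Suc (card T)" 
          using T0(1) finite_subset[OF T0(1)] by (simp add: card_insert_if)
        then show ?thesis using T0 by (intro exI[of _ "insert F T0"]) auto
      qed
      have inter: "exact_at V q (\<Union>G\<in>set ?As. Pow G) TYPE('g)"
      proof (rule outer)
        show "\<And>G. G \<in> set ?As \<Longrightarrow> G \<subseteq> V" using sub by auto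
        \<comment> \<open>The linkage with \<open>T = {}\<close>, whose intersection is the whole
          type: linked simplices meet. For \<open>q = 0\<close> the hypothesis \<open>meet\<close>
          concerns single sets only and does not give this.\<close>
        from par obtain G where "G \<in> set Fs" "?R G F" by auto
        moreover from this(2) have "G \<inter> F \<noteq> {}" by (auto dest: spec[of _ "{}"])
        ultimately show "\<exists>G\<in>set ?As. G \<noteq> {}" by auto
        show "\<Inter>T \<noteq> {}" if T: "T \<subseteq> set ?As" "T \<noteq> {}" "card T \<le> q" for T
        proof -
          obtain T' where T': "T' \<subseteq> set (F # Fs)" "card T' \<le> Suc (card T)" "F \<in> T'" "\<Inter>T' = F \<inter> \<Inter>T"
            using lift[OF T(1)] by blast
          then have "\<Inter>T' \<noteq> {}" using T(3) by (intro meet) auto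
          then show ?thesis using T'(4) by auto
        qed
        show "linked (\<lambda>G H. \<forall>T. T \<subseteq> set ?As \<longrightarrow> card T < q \<longrightarrow> G \<inter> H \<inter> \<Inter>T \<noteq> {}) ?As"
        proof (rule linked_map[OF lnk'])
          fix G H
          assume R: "?R G H"
          have "(G \<inter> F) \<inter> (H \<inter> F) \<inter> \<Inter>T \<noteq> {}" if T: "T \<subseteq> set ?As" "card T < q" for T
          proof -
          obtain T' where T': "T' \<subseteq> set (F # Fs)" "card T' \<le> Suc (card T)" "F \<in> T'" "\<Inter>T' = F \<inter> \<Inter>T"
            using lift[OF T(1)] by blast
          have "card T' < Suc q" using T'(2) T(2) by linarith
          with R T'(1) have "G \<inter> H \<inter> \<Inter>T' \<noteq> {}" by blast
          then obtain x where "x \<in> G" "x \<in> H" "x \<in> \<Inter>T'" by blast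
          then have "x \<in> (G \<inter> F) \<inter> (H \<inter> F) \<inter> \<Inter>T" unfolding T'(4) by simp
          then show ?thesis by blast
          qed
          then show "\<forall>T. T \<subseteq> set ?As \<longrightarrow> card T < q \<longrightarrow> (G \<inter> F) \<inter> (H \<inter> F) \<inter> \<Inter>T \<noteq> {}" by blast
        qed
      qed
      have "exact_at V (Suc q) ((\<Union>F\<in>set Fs. Pow F) \<union> Pow F) TYPE('g)"
      proof (rule exact_at_union[OF V _ _ _ _ rest simplex])
        have "(\<Union>G\<in>set ?As. Pow G) = (\<Union>F\<in>set Fs. Pow F) \<inter> Pow F" by auto
        then show "exact_at V q ((\<Union>F\<in>set Fs. Pow F) \<inter> Pow F) TYPE('g)" using inter by simp
      qed (use sub in auto, blast)
      then show ?thesis by (simp add: Un_commute)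
    qed
  qed
qed

section \<open>Vanishing of homology for few vertices\<close>

lemma trivial_homology_group_iff:
  fixes X :: "'v::linorder set set"
  assumes "simplicial_complex X" "finite X"
  shows "trivial_group (homology_group n X :: ('v set \<Rightarrow> 'g::ab_group_add) set monoid) \<longleftrightarrow>
    (cycles n X :: ('v set \<Rightarrow> 'g) set) \<subseteq> boundaries n X"
proof -
  let ?Z = "cycle_group n X :: ('v set \<Rightarrow> 'g) monoid" and ?B = "boundaries n X :: ('v set \<Rightarrow> 'g) set"
  interpret Z: comm_group ?Z by (rule comm_group_cycle_group)
  have B: "subgroup ?B ?Z" by (rule subgroup_boundaries[OF assms])
  have "trivial_group (homology_group n X :: ('v set \<Rightarrow> 'g) set monoid) \<longleftrightarrow>
      (\<lambda>x. ?B #>\<^bsub>?Z\<^esub> x) ` carrier ?Z \<subseteq> {?B}"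
    unfolding group.trivial_group_subset[OF group_homology_group[OF assms]]
    by (simp add: homology_group_def carrier_FactGroup)
  also have "\<dots> \<longleftrightarrow> carrier ?Z \<subseteq> ?B"
  proof -
    have "?B #>\<^bsub>?Z\<^esub> x = ?B \<longleftrightarrow> x \<in> ?B" if "x \<in> carrier ?Z" for x
      using Z.coset_join1[OF _ that B] Z.coset_join2[OF that B] by blast
    then show ?thesis by blast
  qed
  finally show ?thesis by (simp add: cycle_group_def)
qed

lemma simplicial_complexD:
  assumes "simplicial_complex X" "\<sigma> \<in> X"
  shows "finite \<sigma>" "\<sigma> \<noteq> {}" "\<And>\<tau>. \<tau> \<subseteq> \<sigma> \<Longrightarrow> \<tau> \<noteq> {} \<Longrightarrow> \<tau> \<in> X"
  using assms unfolding simplicial_complex_def by blast+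

text \<open>Adding \<open>{}\<close> changes the boundary on vertices only, hence neither cycles nor
  boundaries in a degree \<open>k \<ge> 1\<close>.\<close>

lemma cycles_subset_boundaries:
  fixes X :: "'v::linorder set set"
  assumes X: "simplicial_complex X" and "1 \<le> k"
    and ex: "exact_at (\<Union>X) (Suc k) (insert {} X) TYPE('g::ab_group_add)"
  shows "(cycles k X :: ('v set \<Rightarrow> 'g) set) \<subseteq> boundaries k X"
proof
  fix c :: "'v set \<Rightarrow> 'g" assume "c \<in> cycles k X"
  then have c: "c \<in> simplicial_chains k X" and cyc: "boundary X c = (\<lambda>_. 0)"
    by (auto simp: cycles_def)
  have supp: "\<sigma> \<in> X \<and> card \<sigma> = Suc k" if "c \<sigma> \<noteq> 0" for \<sigma>
    using c that by (auto simp: simplicial_chains_def faces_def)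
  have same: "boundary (Pow (\<Union>X)) b \<tau> = boundary X b \<tau>" if "\<tau> \<in> X" for b :: "'v set \<Rightarrow> 'g" and \<tau>
    using that by (auto simp: boundary_def)
  have "boundary (Pow (\<Union>X)) c \<tau> = 0" for \<tau>
  proof (cases "\<tau> \<in> X")
    case True
    then show ?thesis using same cyc by simp
  next
    case False
    have "c (insert v \<tau>) = 0" if "v \<notin> \<tau>" for v
    proof (rule ccontr)
      assume "c (insert v \<tau>) \<noteq> 0"
      then have *: "insert v \<tau> \<in> X" "card (insert v \<tau>) = Suc k" using supp by auto
      then have "\<tau> \<noteq> {}" using \<open>1 \<le> k\<close> by auto
      then show False using simplicial_complexD(3)[OF X *(1)] False by blast
    qed
    then show ?thesis by (simp add: boundary_def)
  qed
  moreover have "c \<in> aug_chains (Suc k) (insert {} X)" using supp by (auto simp: aug_chains_def)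
  ultimately obtain b where b: "b \<in> aug_chains (Suc (Suc k)) (insert {} X)" "boundary (Pow (\<Union>X)) b = c"
    using ex unfolding exact_at_def by blast
  have "boundary X b = c"
  proof
    fix \<tau>
    show "boundary X b \<tau> = c \<tau>"
      using same[of \<tau> b] b(2) supp[of \<tau>] by (cases "\<tau> \<in> X") (auto simp: boundary_def)
  qed
  moreover have "b \<in> simplicial_chains (Suc k) X"
    using b(1) by (auto simp: aug_chains_def simplicial_chains_def faces_def)
  ultimately show "c \<in> boundaries k X" by (auto simp: boundaries_def)
qed

text \<open>A union bound: each member of \<open>T\<close> removes at most \<open>e\<close> vertices
  from \<open>A\<close>.\<close>

lemma card_le_card_Inter:
  assumes "finite V" "A \<subseteq> V" "finite T" "\<And>F. F \<in> T \<Longrightarrow> card (V - F) \<le> e"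
  shows "card A \<le> card (A \<inter> \<Inter>T) + card T * e"
  using assms(3,4)
proof (induction T)
  case (insert F T)
  have fin: "finite A" using assms(1,2) finite_subset by blast
  have "card (A \<inter> \<Inter>T) \<le> card (A \<inter> \<Inter>T \<inter> F) + card (A \<inter> \<Inter>T - F)"
    using card_Un_le[of "A \<inter> \<Inter>T \<inter> F" "A \<inter> \<Inter>T - F"] by (simp add: Int_Diff_Un)
  also have "card (A \<inter> \<Inter>T - F) \<le> card (V - F)"
    using assms(1,2) by (intro card_mono) auto
  also have "card (V - F) \<le> e" using insert.prems by simp
  finally have "card (A \<inter> \<Inter>T) \<le> card (A \<inter> \<Inter>(insert F T)) + e"
    by (simp add: Int_ac)
  then show ?case using insert by simp
qed simp

text \<open>Adjacent \<open>m\<close>-faces share \<open>m\<close> vertices, hence so do any facets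
  above them. Along a chain of \<open>m\<close>-faces, purity supplies a facet above each.\<close>

lemma facets_connected:
  assumes X: "pure_complex d X" and sc: "strongly_connected m X" and m: "1 \<le> m" "m \<le> d"
    and FG: "F \<in> faces d X" "G \<in> faces d X"
  shows "(\<lambda>F G. F \<in> faces d X \<and> G \<in> faces d X \<and> m \<le> card (F \<inter> G))\<^sup>*\<^sup>* F G"
proof -
  let ?R = "\<lambda>F G. F \<in> faces d X \<and> G \<in> faces d X \<and> m \<le> card (F \<inter> G)"
  have cx: "simplicial_complex X" using X by (simp add: pure_complex_def)
  have fin: "finite H" if "H \<in> faces d X" for H
    using that simplicial_complexD(1)[OF cx] by (auto simp: faces_def)
  \<comment> \<open>Serves both for facets above one \<open>m\<close>-face and for facets above two
    adjacent ones.\<close>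
  have R: "?R\<^sup>*\<^sup>* H G" if "\<rho> \<subseteq> H" "\<rho> \<subseteq> G" "m \<le> card \<rho>" "H \<in> faces d X" "G \<in> faces d X" for \<rho> G H
    using that card_mono[of "H \<inter> G" \<rho>] fin by (intro r_into_rtranclp) auto
  \<comment> \<open>The facet \<open>G\<close> stays arbitrary, so that the induction can pass
    through any facet above an intermediate \<open>m\<close>-face.\<close>
  have step: "?R\<^sup>*\<^sup>* F G"
    if "equivclp (adjacent_faces m X) \<sigma> \<tau>" "F \<in> faces d X" "\<sigma> \<subseteq> F" "\<sigma> \<in> faces m X" "G \<in> faces d X" "\<tau> \<subseteq> G"
    for \<sigma> \<tau> G
    using that
  proof (induction arbitrary: G rule: equivclp_induct)
    case base
    then show ?case by (intro R[of \<sigma>]) (auto simp: faces_def)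
  next
    case (step y z)
    then have adj: "adjacent_faces m X y z \<or> adjacent_faces m X z y" by simp
    then have "y \<in> X" by (auto simp: adjacent_faces_def faces_def)
    then obtain H where H: "H \<in> faces d X" "y \<subseteq> H" using X by (auto simp: pure_complex_def)
    obtain \<rho> where "\<rho> \<in> faces (m - 1) X" "\<rho> \<subseteq> y" "\<rho> \<subseteq> z"
      using adj by (auto simp: adjacent_faces_def)
    then have "?R\<^sup>*\<^sup>* H G" using H step.prems m by (intro R[of \<rho>]) (auto simp: faces_def)
    moreover have "?R\<^sup>*\<^sup>* F H" using step H by blast
    ultimately show ?case by (rule rtranclp_trans[rotated])
  qed
  have sub: "\<exists>\<sigma>\<in>faces m X. \<sigma> \<subseteq> H" if H: "H \<in> faces d X" for H
  proof -
    have "Suc m \<le> card H" using H m by (auto simp: faces_def)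
    then obtain \<sigma> where "\<sigma> \<subseteq> H" "card \<sigma> = Suc m" by (meson obtain_subset_with_card_n)
    moreover from this have "\<sigma> \<in> X" using H simplicial_complexD(3)[OF cx, of H \<sigma>] by (fastforce simp: faces_def)
    ultimately show ?thesis by (auto simp: faces_def)
  qed
  obtain \<sigma> \<tau> where st: "\<sigma> \<in> faces m X" "\<sigma> \<subseteq> F" "\<tau> \<in> faces m X" "\<tau> \<subseteq> G" using sub FG by blast
  then have "equivclp (adjacent_faces m X) \<sigma> \<tau>" using sc by (auto simp: strongly_connected_def)
  then show ?thesis using step st FG by blast
qed

lemma homology_trivial_if_few_vertices:
  fixes X :: "'v::linorder set set"
  assumes fX: "finite X" and X: "pure_complex d X" and sc: "strongly_connected m X"
    and k: "1 \<le> k" and m: "1 \<le> m" "m \<le> d"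
    and few: "k * (card (\<Union>X) - Suc d) < m"
  shows "trivial_group (homology_group k X :: ('v set \<Rightarrow> 'g::ab_group_add) set monoid)"
\<comment> \<open>The empty complex has no facet, so \<open>insert {} X\<close> is then not the
  union of the \<open>Pow F\<close>.\<close>
proof (cases "X = {}")
  case True
  then have "simplicial_complex X" by (simp add: simplicial_complex_def)
  have "c = (\<lambda>_. 0)" if "c \<in> cycles k X" for c :: "'v set \<Rightarrow> 'g"
    using that True by (auto simp: cycles_def simplicial_chains_def faces_def)
  moreover have "(\<lambda>_. 0) \<in> (boundaries k X :: ('v set \<Rightarrow> 'g) set)"
    unfolding boundaries_def
    by (rule image_eqI[where x = "\<lambda>_. 0"]) (simp_all add: boundary_zero simplicial_chains_def)
  ultimately show ?thesis
    unfolding trivial_homology_group_iff[OF \<open>simplicial_complex X\<close> fX] by blast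
next
  case False
  have cx: "simplicial_complex X" using X by (simp add: pure_complex_def)
  let ?V = "\<Union>X" and ?D = "faces d X"
  define e where "e = card ?V - Suc d"
  have fV: "finite ?V" using fX simplicial_complexD(1)[OF cx] by auto
  have D: "F \<subseteq> ?V" "finite F" "card F = Suc d" "card (?V - F) = e" if "F \<in> ?D" for F
  proof -
    show *: "F \<subseteq> ?V" "card F = Suc d" using that by (auto simp: faces_def)
    then show "finite F" using fV finite_subset by auto
    then show "card (?V - F) = e" using * by (simp add: e_def card_Diff_subset)
  qed
  have fD: "finite ?D" using fX by (simp add: faces_def)
  let ?R = "\<lambda>F G. F \<in> ?D \<and> G \<in> ?D \<and> m \<le> card (F \<inter> G)"
  have "\<exists>Fs. set Fs = ?D \<and> linked ?R Fs"
    by (rule linked_enumeration[OF fD]) (use facets_connected[OF X sc m] in auto)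
  then obtain Fs where Fs: "set Fs = ?D" "linked ?R Fs" by blast
  \<comment> \<open>Each facet misses \<open>e\<close> vertices, so \<open>k\<close> facets cannot
    exhaust \<open>m\<close> of them, as \<open>k * e < m\<close>. Used with \<open>A\<close> a
    facet and with \<open>A\<close> the intersection of two linked facets.\<close>
  have meet: "A \<inter> \<Inter>T \<noteq> {}" if A: "A \<subseteq> ?V" "m \<le> card A" and T: "T \<subseteq> ?D" "card T \<le> k" for A T
  proof -
    have "card A \<le> card (A \<inter> \<Inter>T) + card T * e"
      using A(1) T(1) D(4) finite_subset[OF _ fD] by (intro card_le_card_Inter[OF fV]) auto
    moreover have "card T * e \<le> k * e" using T(2) by simp
    moreover have "k * e < m" using few by (simp add: e_def)
    ultimately have "card (A \<inter> \<Inter>T) \<noteq> 0" using A(2) by linarith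
    then show ?thesis by auto
  qed
  have "exact_at ?V (Suc k) (\<Union>F\<in>set Fs. Pow F) TYPE('g)"
  proof (rule exact_at_linked_union[OF fV])
    show "\<And>F. F \<in> set Fs \<Longrightarrow> F \<subseteq> ?V" using D Fs(1) by auto
    obtain F where "F \<in> ?D" using False X by (auto simp: pure_complex_def)
    then show "\<exists>F\<in>set Fs. F \<noteq> {}" using D(3) Fs(1) by (metis card.empty nat.distinct(1))
    show "\<Inter>T \<noteq> {}" if T: "T \<subseteq> set Fs" "T \<noteq> {}" "card T \<le> Suc k" for T
    proof -
      obtain F where F: "F \<in> T" using T by auto
      then have "F \<in> ?D" using T Fs by auto
      moreover have "finite T" using T(1) by (simp add: finite_subset)
      \<comment> \<open>One of the at most \<open>k + 1\<close> facets takes the place of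
        \<open>A\<close>, which leaves at most \<open>k\<close>.\<close>
      ultimately have "F \<inter> \<Inter>(T - {F}) \<noteq> {}"
        using T F D[of F] m Fs by (intro meet) auto
      then show ?thesis using F by blast
    qed
    show "linked (\<lambda>G H. \<forall>T. T \<subseteq> set Fs \<longrightarrow> card T < Suc k \<longrightarrow> G \<inter> H \<inter> \<Inter>T \<noteq> {}) Fs"
    proof (rule linked_mono[OF Fs(2)], intro allI impI)
      fix F G T assume "?R F G" "T \<subseteq> set Fs" "card T < Suc k"
      then show "F \<inter> G \<inter> \<Inter>T \<noteq> {}" using D(1) Fs(1) by (intro meet) auto
    qed
  qed
  moreover have "(\<Union>F\<in>set Fs. Pow F) = insert {} X"
  proof -
    have "\<tau> \<in> insert {} X" if "F \<in> ?D" "\<tau> \<subseteq> F" for \<tau> F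
      using that simplicial_complexD(3)[OF cx, of F \<tau>] by (auto simp: faces_def)
    moreover have "\<exists>F\<in>?D. \<tau> \<subseteq> F" if "\<tau> \<in> insert {} X" for \<tau>
      using that X False unfolding pure_complex_def by blast
    ultimately show ?thesis unfolding Fs(1) by blast
  qed
  ultimately show ?thesis
    unfolding trivial_homology_group_iff[OF cx fX] by (intro cycles_subset_boundaries[OF cx k]) simp
qed

text \<open>The sign rule alone shows only that twice the sum vanishes, too little in the presence
  of 2-torsion. Comparing by \<open>key\<close> selects one element of each pair, so that the pairs
  cancel.\<close>

lemma sum_sign_reversing_involution:
  fixes f :: "'a \<Rightarrow> 'g::ab_group_add" and key :: "'a \<Rightarrow> 'b::linorder"
  assumes "finite P" and closed: "\<And>x. x \<in> P \<Longrightarrow> \<iota> x \<in> P" and inv: "\<And>x. x \<in> P \<Longrightarrow> \<iota> (\<iota> x) = x"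
    and sign: "\<And>x. x \<in> P \<Longrightarrow> f (\<iota> x) = - f x" and key: "\<And>x. x \<in> P \<Longrightarrow> key (\<iota> x) \<noteq> key x"
  shows "sum f P = 0"
proof -
  let ?L = "{x \<in> P. key (\<iota> x) < key x}" and ?U = "{x \<in> P. key x < key (\<iota> x)}"
  have "P = ?L \<union> ?U" using key by (auto simp: neq_iff)
  then have "sum f P = sum f (?L \<union> ?U)" by simp
  also have "\<dots> = sum f ?L + sum f ?U"
    using assms(1) by (intro sum.union_disjoint) auto
  also have "sum f ?U = (\<Sum>x\<in>?L. - f x)"
    by (rule sum.reindex_bij_witness[of _ \<iota> \<iota>]) (auto simp: closed inv sign)
  finally show ?thesis by (simp add: sum_negf)
qed

section \<open>A minimal complex with nontrivial homology\<close>

text \<open>\<open>\<phi>\<close> colours the vertices \<open>{..<N}\<close> with the colours \<open>{..k}\<close>; the vertices from \<open>N\<close> on form the set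
  lying in all the simplices \<open>V - E j\<close>. Since \<open>E j\<close> contains the whole colour class \<open>j\<close>, a simplex with
  all colours avoids the vertices from \<open>N\<close> on. The sets \<open>E j\<close> may overlap, but only outside \<open>w ` {..k}\<close>.\<close>

locale coloured_complex =
  fixes d k m N :: nat and \<phi> w :: "nat \<Rightarrow> nat" and E :: "nat \<Rightarrow> nat set"
  assumes kd: "k \<le> d" and m: "1 \<le> m" "m \<le> d" and dN: "d < N"
    and mono: "mono \<phi>" and \<phi>: "\<And>x. x < N \<Longrightarrow> \<phi> x \<le> k" "\<And>x. x < N \<Longrightarrow> x \<in> E (\<phi> x)"
    and w: "\<And>j. j \<le> k \<Longrightarrow> w j < N" "\<And>j. j \<le> k \<Longrightarrow> \<phi> (w j) = j"
    and E: "\<And>j. j \<le> k \<Longrightarrow> E j \<subseteq> {..<N}" "\<And>j. j \<le> k \<Longrightarrow> card (E j) = N - m"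
    and wE: "\<And>i j. i \<le> k \<Longrightarrow> j \<le> k \<Longrightarrow> i \<noteq> j \<Longrightarrow> w i \<notin> E j"
begin

text \<open>The \<open>d + 1 - m\<close> vertices outside \<open>{..<N}\<close> complete the
  \<open>m\<close> vertices of \<open>{..<N} - E j\<close> to a facet.\<close>

definition V :: "nat set" where "V = {..<N + (Suc d - m)}"

definition Y :: "nat set set" where
  "Y = {\<sigma>. \<sigma> \<noteq> {} \<and> (\<sigma> \<subseteq> {..<N} \<and> card \<sigma> \<le> Suc d \<or> (\<exists>j\<le>k. \<sigma> \<subseteq> V - E j))}"

lemma finite_V: "finite V" by (simp add: V_def)

lemma N_subset_V: "{..<N} \<subseteq> V" by (auto simp: V_def)

lemma Y_subset_V: "\<sigma> \<in> Y \<Longrightarrow> \<sigma> \<subseteq> V" using N_subset_V by (auto simp: Y_def)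

lemma card_facet: "j \<le> k \<Longrightarrow> card (V - E j) = Suc d"
  using E[of j] N_subset_V finite_subset[of "E j" "{..<N}"] m dN
  by (subst card_Diff_subset) (auto simp: V_def)

lemma simplicial_complex_Y: "simplicial_complex Y"
  unfolding simplicial_complex_def
proof (intro conjI ballI allI impI)
  fix \<sigma> assume \<sigma>: "\<sigma> \<in> Y"
  show fin: "finite \<sigma>" using Y_subset_V[OF \<sigma>] finite_V by (rule finite_subset)
  show "\<sigma> \<noteq> {}" using \<sigma> by (simp add: Y_def)
  fix \<tau> assume "\<tau> \<subseteq> \<sigma> \<and> \<tau> \<noteq> {}"
  moreover from this have "card \<tau> \<le> card \<sigma>" using fin by (simp add: card_mono)
  ultimately show "\<tau> \<in> Y" using \<sigma> unfolding Y_def by (auto 0 4)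
qed

lemma finite_Y: "finite Y"
  by (rule finite_subset[of _ "Pow V"]) (use Y_subset_V finite_V in auto)

lemma pure_Y: "pure_complex d Y"
  unfolding pure_complex_def
proof (intro conjI ballI simplicial_complex_Y)
  fix \<sigma> assume "\<sigma> \<in> Y"
  then consider "\<sigma> \<subseteq> {..<N}" "card \<sigma> \<le> Suc d" | j where "j \<le> k" "\<sigma> \<subseteq> V - E j"
    by (auto simp: Y_def)
  then show "\<exists>\<tau>\<in>faces d Y. \<sigma> \<subseteq> \<tau>"
  proof cases
    case 1
    then obtain \<tau> where "\<sigma> \<subseteq> \<tau>" "\<tau> \<subseteq> {..<N}" "card \<tau> = Suc d"
      using exists_subset_between[of \<sigma> "Suc d" "{..<N}"] dN by auto
    then show ?thesis by (intro bexI[of _ \<tau>]) (auto simp: faces_def Y_def)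
  next
    case 2
    moreover from this have "V - E j \<noteq> {}" using card_facet[of j] by (metis card.empty nat.distinct(1))
    ultimately have "V - E j \<in> faces d Y" using card_facet[of j] unfolding faces_def Y_def by blast
    then show ?thesis using 2 by blast
  qed
qed

lemma Union_Y: "\<Union>Y = V"
proof
  show "\<Union>Y \<subseteq> V" using Y_subset_V by blast
  have "{v} \<in> Y" if "v \<in> V" for v
    using that E(1)[of 0] by (cases "v < N") (auto simp: Y_def)
  then show "V \<subseteq> \<Union>Y" by blast
qed

section \<open>Strong connectivity of the example\<close>

abbreviation conn :: "nat set \<Rightarrow> nat set \<Rightarrow> bool" where
  "conn \<equiv> equivclp (adjacent_faces m Y)"

text \<open>Exchanging a vertex of \<open>\<sigma> - \<tau>\<close> for one of
  \<open>\<tau> - \<sigma>\<close> keeps an \<open>(m - 1)\<close>-face and decreases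
  \<open>card (\<sigma> - \<tau>)\<close>.\<close>

lemma conn_within:
  assumes U: "finite U" "\<And>\<sigma>. \<sigma> \<subseteq> U \<Longrightarrow> card \<sigma> = Suc m \<Longrightarrow> \<sigma> \<in> Y"
    and "\<sigma> \<subseteq> U" "card \<sigma> = Suc m" "\<tau> \<subseteq> U" "card \<tau> = Suc m"
  shows "conn \<sigma> \<tau>"
  using assms(3,4)
proof (induction "card (\<sigma> - \<tau>)" arbitrary: \<sigma>)
  case 0
  have fin: "finite \<sigma>" "finite \<tau>" using 0 assms U(1) finite_subset by auto
  then have "\<sigma> \<subseteq> \<tau>" using 0 by auto
  then have "\<sigma> = \<tau>" using 0 assms fin card_subset_eq by metis
  then show ?case by simp
next
  case (Suc i)
  have fin: "finite \<sigma>" "finite \<tau>" using Suc.prems assms U(1) finite_subset by auto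
  obtain x where x: "x \<in> \<sigma>" "x \<notin> \<tau>" using Suc.hyps(2) by (metis Diff_iff card_eq_0_iff equals0I nat.distinct(1))
  have "\<not> \<tau> \<subseteq> \<sigma>"
    using x Suc.prems assms fin card_subset_eq by metis
  then obtain y where y: "y \<in> \<tau>" "y \<notin> \<sigma>" by auto
  let ?\<rho> = "\<sigma> - {x}"
  have c\<rho>: "card ?\<rho> = m" using x Suc.prems fin by simp
  \<comment> \<open>By \<open>m \<ge> 1\<close> the shared face is nonempty and therefore belongs to
    \<open>Y\<close>.\<close>
  then have "?\<rho> \<noteq> {}" using m by (metis card.empty not_one_le_zero)
  then have \<rho>: "?\<rho> \<in> faces (m - 1) Y"
    using c\<rho> m(1) simplicial_complexD(3)[OF simplicial_complex_Y U(2)[OF Suc.prems], of ?\<rho>]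
    by (simp add: faces_def)
  have \<sigma>': "insert y ?\<rho> \<subseteq> U" "card (insert y ?\<rho>) = Suc m"
    using y c\<rho> fin Suc.prems assms by auto
  have "insert y ?\<rho> - \<tau> = (\<sigma> - \<tau>) - {x}" using y by auto
  then have "card (insert y ?\<rho> - \<tau>) = i" using Suc.hyps(2) x fin by simp
  then have "conn (insert y ?\<rho>) \<tau>" using Suc.hyps(1) \<sigma>' by blast
  moreover have "adjacent_faces m Y \<sigma> (insert y ?\<rho>)"
    unfolding adjacent_faces_def
  proof (intro conjI bexI[OF _ \<rho>])
    show "\<sigma> \<in> faces m Y" "insert y ?\<rho> \<in> faces m Y"
      using U(2)[OF \<sigma>'] U(2)[OF Suc.prems] \<sigma>' Suc.prems by (simp_all add: faces_def)
  qed auto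
  ultimately show ?case by (meson equivclp_trans r_into_equivclp)
qed

text \<open>The \<open>m\<close>-faces inside \<open>{..<N}\<close> are connected there, those of
  each \<open>V - E j\<close> among themselves, and a single step joins the two kinds.\<close>

lemma strongly_connected_Y: "strongly_connected m Y"
proof -
  have Wconn: "conn \<sigma> \<tau>" if "\<sigma> \<subseteq> {..<N}" "card \<sigma> = Suc m" "\<tau> \<subseteq> {..<N}" "card \<tau> = Suc m" for \<sigma> \<tau>
    using that m by (intro conn_within[of "{..<N}"]) (auto simp: Y_def)
  have toW: "\<exists>\<tau>. \<tau> \<subseteq> {..<N} \<and> card \<tau> = Suc m \<and> conn \<sigma> \<tau>" if \<sigma>: "\<sigma> \<in> faces m Y" for \<sigma>
  proof (cases "\<sigma> \<subseteq> {..<N}")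
    case True
    then show ?thesis using \<sigma> by (intro exI[of _ \<sigma>]) (auto simp: faces_def)
  next
    case False
    then obtain j where j: "j \<le> k" "\<sigma> \<subseteq> V - E j" using \<sigma> by (auto simp: faces_def Y_def)
    \<comment> \<open>\<open>V - E j\<close> meets \<open>{..<N}\<close> in exactly \<open>m\<close>
      vertices. Adding the outer vertex \<open>N\<close> or a vertex of \<open>E j\<close> yields
      two adjacent \<open>m\<close>-faces, one on each side.\<close>
    define \<rho> where "\<rho> = {..<N} - E j"
    have c\<rho>: "card \<rho> = m"
      using E[OF j(1)] finite_subset[of "E j" "{..<N}"] dN m by (simp add: \<rho>_def card_Diff_subset)
    have \<rho>V: "\<rho> \<subseteq> V - E j" using N_subset_V by (auto simp: \<rho>_def)
    then have \<rho>Y: "\<rho> \<in> faces (m - 1) Y" using c\<rho> m j by (auto simp: faces_def Y_def)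
    have "E j \<noteq> {}" using E(2)[OF j(1)] m dN by auto
    then obtain x where x: "x \<in> E j" "x < N" using E(1)[OF j(1)] by auto
    have xW: "insert x \<rho> \<subseteq> {..<N}" "card (insert x \<rho>) = Suc m"
      using x c\<rho> by (auto simp: \<rho>_def)
    have N: "N \<in> V" "N \<notin> E j" using E(1)[OF j(1)] m by (auto simp: V_def)
    have NV: "insert N \<rho> \<subseteq> V - E j" "card (insert N \<rho>) = Suc m"
      using N \<rho>V c\<rho> by (auto simp: \<rho>_def)
    have "conn \<sigma> (insert N \<rho>)"
      using \<sigma> j NV finite_V by (intro conn_within[of "V - E j"]) (auto simp: faces_def Y_def)
    moreover have "adjacent_faces m Y (insert N \<rho>) (insert x \<rho>)"
      unfolding adjacent_faces_def
    proof (intro conjI bexI[OF _ \<rho>Y])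
      show "insert N \<rho> \<in> faces m Y" using NV j by (auto simp: faces_def Y_def)
      show "insert x \<rho> \<in> faces m Y" using xW m by (auto simp: faces_def Y_def)
    qed auto
    ultimately show ?thesis using xW by (meson equivclp_trans r_into_equivclp)
  qed
  show ?thesis
    unfolding strongly_connected_def using toW Wconn by (meson equivclp_sym equivclp_trans)
qed

section \<open>The homology class of the example\<close>

definition rainbow :: "nat set set" where
  "rainbow = {\<sigma>. \<sigma> \<subseteq> {..<N} \<and> \<phi> ` \<sigma> = {..k} \<and> card \<sigma> = Suc k}"

text \<open>Summing over the rainbow simplices is the cocycle detecting the homology class. Monotonicity of
  the colouring makes all its signs equal to 1: exchanging the two vertices of equal colour in a
  simplex over \<open>{..<N}\<close> changes the sign, because no other vertex lies between them.\<close>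

lemma rainbow_sum_boundary:
  fixes b :: "nat set \<Rightarrow> 'g::ab_group_add"
  assumes b: "\<And>\<sigma>. b \<sigma> \<noteq> 0 \<Longrightarrow> \<sigma> \<in> Y"
  shows "(\<Sum>\<sigma>\<in>rainbow. boundary Y b \<sigma>) = 0"
proof -
  have fin: "finite rainbow" by (rule finite_subset[of _ "Pow {..<N}"]) (auto simp: rainbow_def)
  \<comment> \<open>An outer vertex forces the simplex into some \<open>V - E j\<close>, which has
    no vertex of colour \<open>j\<close>.\<close>
  have outer: "b (insert v \<sigma>) = 0" if \<sigma>v: "\<sigma> \<in> rainbow" "v \<in> V - {..<N}" for \<sigma> v
  proof (rule ccontr)
    assume "b (insert v \<sigma>) \<noteq> 0"
    then have "insert v \<sigma> \<in> Y" by (rule b)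
    then obtain j where j: "j \<le> k" "insert v \<sigma> \<subseteq> V - E j" using \<sigma>v by (auto simp: Y_def)
    then have "j \<in> \<phi> ` \<sigma>" using that by (auto simp: rainbow_def)
    then obtain x where "x \<in> \<sigma>" "\<phi> x = j" by auto
    then show False using \<phi>(2)[of x] that j by (auto simp: rainbow_def)
  qed
  let ?h = "\<lambda>(\<sigma>, v). incidence v \<sigma> (b (insert v \<sigma>))"
  let ?P = "Sigma rainbow (\<lambda>\<sigma>. {..<N} - \<sigma>)"
  have "boundary Y b \<sigma> = (\<Sum>v\<in>{..<N} - \<sigma>. ?h (\<sigma>, v))" if \<sigma>: "\<sigma> \<in> rainbow" for \<sigma>
  proof -
    have "\<sigma> \<in> Y" using \<sigma> kd by (auto simp: rainbow_def Y_def)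
    then have "boundary Y b \<sigma> = (\<Sum>v\<in>V - \<sigma>. ?h (\<sigma>, v))"
      by (simp add: boundary_def Union_Y)
    also have "\<dots> = (\<Sum>v\<in>{..<N} - \<sigma>. ?h (\<sigma>, v))"
    proof (rule sum.mono_neutral_right)
      show "\<forall>v\<in>V - \<sigma> - ({..<N} - \<sigma>). ?h (\<sigma>, v) = 0"
      proof
        fix v assume "v \<in> V - \<sigma> - ({..<N} - \<sigma>)"
        then have "v \<in> V - {..<N}" by auto
        then show "?h (\<sigma>, v) = 0" using outer[OF \<sigma>] by simp
      qed
    qed (use N_subset_V finite_V in auto)
    finally show ?thesis .
  qed
  then have "(\<Sum>\<sigma>\<in>rainbow. boundary Y b \<sigma>) = (\<Sum>\<sigma>\<in>rainbow. \<Sum>v\<in>{..<N} - \<sigma>. ?h (\<sigma>, v))"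
    by simp
  also have "\<dots> = sum ?h ?P" using fin by (simp add: sum.Sigma)
  also have "\<dots> = 0"
  proof -
    \<comment> \<open>\<open>insert v \<sigma>\<close> has exactly two vertices of the colour of
      \<open>v\<close>: \<open>v\<close> and its \<open>mate\<close>. Dropping either one leaves a
      rainbow simplex, and \<open>swp\<close> passes between these two descriptions of one
      simplex.\<close>
    define mate where "mate = (\<lambda>(\<sigma>, v). inv_into \<sigma> \<phi> (\<phi> v))"
    define swp where "swp = (\<lambda>(\<sigma>, v). (insert v (\<sigma> - {mate (\<sigma>, v)}), mate (\<sigma>, v)))"
    have inj: "inj_on \<phi> \<sigma>" if "\<sigma> \<in> rainbow" for \<sigma>
      using that finite_subset[of \<sigma> "{..<N}"] by (intro eq_card_imp_inj_on) (auto simp: rainbow_def)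
    have main: "\<exists>\<rho> u. finite \<rho> \<and> \<sigma> = insert u \<rho> \<and> u \<notin> \<rho> \<and> v \<notin> \<rho> \<and> u \<noteq> v \<and> \<phi> u = \<phi> v \<and>
        swp (\<sigma>, v) = (insert v \<rho>, u) \<and> insert v \<rho> \<in> rainbow \<and> u < N \<and> swp (insert v \<rho>, u) = (\<sigma>, v)
        \<and> (\<forall>y\<in>\<rho>. \<phi> y \<noteq> \<phi> v)"
      if x: "(\<sigma>, v) \<in> ?P" for \<sigma> v
    proof -
      have \<sigma>: "\<sigma> \<in> rainbow" and v: "v < N" "v \<notin> \<sigma>" using x by auto
      define u where "u = mate (\<sigma>, v)"
      have "\<phi> v \<in> \<phi> ` \<sigma>" using \<sigma> \<phi>(1)[OF v(1)] by (simp add: rainbow_def)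
      then have u: "u \<in> \<sigma>" "\<phi> u = \<phi> v"
        by (auto simp: u_def mate_def inv_into_into f_inv_into_f)
      define \<rho> where "\<rho> = \<sigma> - {u}"
      have fs: "finite \<sigma>" using \<sigma> finite_subset[of \<sigma> "{..<N}"] by (simp add: rainbow_def)
      have \<rho>: "finite \<rho>" "\<sigma> = insert u \<rho>" "u \<notin> \<rho>" "v \<notin> \<rho>" using fs u v by (auto simp: \<rho>_def)
      have r: "insert v \<rho> \<in> rainbow"
        using \<sigma> \<rho> v u by (auto simp: rainbow_def)
      have "mate (insert v \<rho>, u) = inv_into (insert v \<rho>) \<phi> (\<phi> v)" using u by (simp add: mate_def)
      also have "\<dots> = v" using inj[OF r] by (simp add: inv_into_f_f)
      finally have mv: "mate (insert v \<rho>, u) = v" .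
      have "\<phi> y \<noteq> \<phi> v" if "y \<in> \<rho>" for y
        using inj[OF r] that \<rho>(4) by (auto simp: inj_on_def)
      moreover have "swp (\<sigma>, v) = (insert v \<rho>, u)" by (simp add: swp_def u_def[symmetric] \<rho>_def)
      moreover have "swp (insert v \<rho>, u) = (\<sigma>, v)" using \<rho> by (simp add: swp_def mv)
      moreover have "u < N" using u \<sigma> by (auto simp: rainbow_def)
      moreover have "u \<noteq> v" using u v by auto
      ultimately show ?thesis using \<rho> r u by blast
    qed
    show ?thesis
    proof (rule sum_sign_reversing_involution[where \<iota> = swp and key = snd])
      show "finite ?P" using fin by auto
    next
      fix x assume x: "x \<in> ?P"
      obtain \<sigma> v where xe: "x = (\<sigma>, v)" by (cases x)
      obtain \<rho> u where \<rho>: "finite \<rho>" "\<sigma> = insert u \<rho>" "u \<notin> \<rho>" "v \<notin> \<rho>" and uv: "u \<noteq> v" "\<phi> u = \<phi> v"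
        and swp: "swp (\<sigma>, v) = (insert v \<rho>, u)" "insert v \<rho> \<in> rainbow" "u < N" "swp (insert v \<rho>, u) = (\<sigma>, v)"
        and no: "\<And>y. y \<in> \<rho> \<Longrightarrow> \<phi> y \<noteq> \<phi> v"
        using main[of \<sigma> v] x unfolding xe by blast
      show "swp x \<in> ?P" using swp uv \<rho> by (auto simp: xe)
      show "swp (swp x) = x" using swp by (simp add: xe)
      show "snd (swp x) \<noteq> snd x" using swp uv by (simp add: xe)
      \<comment> \<open>A vertex of \<open>\<rho>\<close> between \<open>u\<close> and
        \<open>v\<close> would have their colour by monotonicity.\<close>
      have "y < u \<longleftrightarrow> y < v" if "y \<in> \<rho>" for y
        using no[OF that] uv monoD[OF mono, of u y] monoD[OF mono, of y v]
          monoD[OF mono, of v y] monoD[OF mono, of y u]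
        by (metis antisym linorder_le_cases nat_less_le)
      then have "{y \<in> \<rho>. y < u} = {y \<in> \<rho>. y < v}" by auto
      then have "incidence u \<rho> g = incidence v \<rho> g" for g :: 'g by (simp add: incidence_def)
      \<comment> \<open>The signs over \<open>\<rho>\<close> agree, and inserting the other vertex
        negates exactly one of the two.\<close>
      then show "?h (swp x) = - ?h x"
        using swp \<rho> uv by (auto simp: xe incidence_insert insert_commute)
    qed
  qed
  finally show ?thesis .
qed

text \<open>The boundary of the simplex \<open>S\<close> on \<open>N\<close> and the
  \<open>w j\<close> is a cycle of \<open>Y\<close>. Its only rainbow face is \<open>B\<close>, so
  its rainbow sum is \<open>g\<close> or \<open>- g\<close>, whereas a boundary has rainbow sum
  0.\<close>

lemma homology_Y:
  assumes "(g :: 'g::ab_group_add) \<noteq> 0"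
  shows "\<not> trivial_group (homology_group k Y :: (nat set \<Rightarrow> 'g) set monoid)"
proof
  assume triv: "trivial_group (homology_group k Y :: (nat set \<Rightarrow> 'g) set monoid)"
  define B where "B = w ` {..k}"
  define S where "S = insert N B"
  define z :: "nat set \<Rightarrow> 'g" where "z = boundary (Pow V) (\<lambda>\<sigma>. if \<sigma> = S then g else 0)"
  have injw: "inj_on w {..k}" using w(2) by (metis atMost_iff inj_onI)
  have B: "B \<subseteq> {..<N}" "card B = Suc k" "finite B"
    using w(1) injw by (auto simp: B_def card_image)
  then have NB: "N \<notin> B" by auto
  then have S: "card S = Suc (Suc k)" "finite S" using B by (simp_all add: S_def)
  have SV: "S \<subseteq> V" using B(1) m by (auto simp: S_def V_def)
  have zS: "z \<in> aug_chains (Suc k) (Pow S)"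
    unfolding z_def using S SV
    by (intro boundary_in_aug_chains finite_V) (auto simp: aug_chains_def)
  have z: "\<sigma> \<subseteq> S" "card \<sigma> = Suc k" if "z \<sigma> \<noteq> 0" for \<sigma>
    using aug_chainsD[OF zS that] by auto
  have zY: "\<sigma> \<in> Y" if "z \<sigma> \<noteq> 0" for \<sigma>
  proof (cases "N \<in> \<sigma>")
    case False
    then have "\<sigma> \<subseteq> B" using z[OF that] by (auto simp: S_def)
    then show ?thesis using B z[OF that] kd by (auto simp: Y_def)
  next
    case True
    \<comment> \<open>A face through \<open>N\<close> has \<open>k + 1\<close> vertices and so omits
      some \<open>w j\<close>. The other \<open>w i\<close> avoid \<open>E j\<close>, which puts the
      face into \<open>V - E j\<close>.\<close>
    have "\<not> B \<subseteq> \<sigma>"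
    proof
      assume "B \<subseteq> \<sigma>"
      then have "\<sigma> = S" using True z[OF that] by (auto simp: S_def)
      then show False using z[OF that] S by simp
    qed
    then obtain j where j: "j \<le> k" "w j \<notin> \<sigma>" by (auto simp: B_def)
    have "\<sigma> \<subseteq> V" using z(1)[OF that] SV by (rule subset_trans)
    moreover have "\<sigma> \<inter> E j = {}"
      using z(1)[OF that] E(1)[OF j(1)] wE[OF _ j(1)] j by (auto simp: S_def B_def)
    ultimately have "\<sigma> \<subseteq> V - E j" by blast
    then show ?thesis using True j by (auto simp: Y_def)
  qed
  have "boundary Y z \<tau> = 0" for \<tau>
  proof (cases "\<tau> \<in> Y")
    case True
    then have "boundary Y z \<tau> = boundary (Pow V) z \<tau>"
      using Y_subset_V by (simp add: boundary_def Union_Y)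
    then show ?thesis unfolding z_def boundary_Pow_boundary[OF finite_V] by simp
  qed (simp add: boundary_def)
  then have "z \<in> cycles k Y"
    using z zY by (auto simp: cycles_def simplicial_chains_def faces_def)
  then have "z \<in> boundaries k Y"
    using triv unfolding trivial_homology_group_iff[OF simplicial_complex_Y finite_Y] by blast
  then obtain b :: "nat set \<Rightarrow> 'g" where b: "b \<in> simplicial_chains (Suc k) Y" "z = boundary Y b"
    by (auto simp: boundaries_def)
  have "(\<Sum>\<sigma>\<in>rainbow. z \<sigma>) = 0"
    unfolding b(2) using b(1) by (intro rainbow_sum_boundary) (auto simp: simplicial_chains_def faces_def)
  moreover have "(\<Sum>\<sigma>\<in>rainbow. z \<sigma>) = (\<Sum>\<sigma>\<in>{B}. z \<sigma>)"
  proof (rule sum.mono_neutral_right)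
    show "finite rainbow" by (rule finite_subset[of _ "Pow {..<N}"]) (auto simp: rainbow_def)
    have "\<phi> ` B = {..k}" using w(2) by (force simp: B_def image_image)
    then show "{B} \<subseteq> rainbow" using B by (auto simp: rainbow_def)
    show "\<forall>\<sigma>\<in>rainbow - {B}. z \<sigma> = 0"
    proof (intro ballI, rule ccontr)
      fix \<sigma> assume \<sigma>: "\<sigma> \<in> rainbow - {B}" and nz: "z \<sigma> \<noteq> 0"
      have "\<sigma> \<subseteq> B" using z(1)[OF nz] \<sigma> by (auto simp: rainbow_def S_def)
      then have "\<sigma> = B" using B z(2)[OF nz] by (simp add: card_subset_eq)
      then show False using \<sigma> by simp
    qed
  qed
  moreover have "z B \<noteq> 0"
  proof -
    have BV: "B \<subseteq> V" using SV by (auto simp: S_def)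
    \<comment> \<open>Only \<open>v = N\<close> completes \<open>B\<close> to
      \<open>S\<close>.\<close>
    have "z B = (\<Sum>v\<in>V - B. if v = N then incidence N B g else 0)"
      unfolding z_def boundary_Pow[OF BV]
      by (intro sum.cong) (auto simp: S_def insert_eq_iff)
    also have "\<dots> = incidence N B g"
      using NB SV finite_V by (simp add: S_def)
    finally show ?thesis using assms by (simp add: incidence_def)
  qed
  ultimately show False by simp
qed

end

text \<open>The inequalities yield \<open>d < m + c\<close> and \<open>k < m\<close>. The first lets
  small simplices of \<open>{..<N}\<close> grow to dimension \<open>d\<close>; the second leaves
  room for padding the colour classes to size \<open>c\<close> away from the other
  \<open>w i\<close>.\<close>

lemma tight_example:
  fixes d k m c :: nat
  assumes k: "1 \<le> k" "k \<le> d" and m: "m \<le> d" and s: "k * (Suc d - m) < m"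
    and c: "m \<le> k * c"
  obtains Y :: "nat set set" where "finite Y" "pure_complex d Y" "strongly_connected m Y"
    "card (\<Union>Y) = Suc d + c"
    "\<And>g :: 'g::ab_group_add. g \<noteq> 0 \<Longrightarrow>
      \<not> trivial_group (homology_group k Y :: (nat set \<Rightarrow> 'g) set monoid)"
proof -
  have "k * (Suc d - m) < k * c" using s c by linarith
  then have sc: "Suc d - m < c" by simp
  have "k * 1 \<le> k * (Suc d - m)" using m by (intro mult_le_mono) auto
  then have km: "k < m" using s by linarith
  \<comment> \<open>With \<open>t + k = N - 1\<close>, position \<open>t + j\<close> is the last
    start of class \<open>j\<close> that leaves a vertex for each of the classes \<open>j\<close> to
    \<open>k\<close>.\<close>
  define t where "t = m + c - Suc k"
  \<comment> \<open>The colour classes are intervals: greedily of length \<open>c\<close>, then of length 1, so that all are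
    nonempty; \<open>w j\<close> is the first element of class \<open>j\<close>.\<close>
  define \<phi> where "\<phi> x = max (x div c) (x - t)" for x
  define w where "w j = min (j * c) (t + j)" for j
  define N where "N = m + c"
  have t: "t + Suc k = N" using km by (simp add: t_def N_def)
  have c0: "0 < c" using sc by simp
  \<comment> \<open>As \<open>N = m + c \<le> (k + 1) * c\<close>, blocks of length \<open>c\<close>
    use no colour above \<open>k\<close>.\<close>
  have \<phi>k: "\<phi> x \<le> k" if "x < N" for x
  proof -
    have "x < Suc k * c" using that c by (simp add: N_def)
    then have "x div c < Suc k" using c0 by (simp add: div_less_iff_less_mult)
    then show ?thesis using that t by (simp add: \<phi>_def)
  qed
  have wN: "w j < N" if "j \<le> k" for j using that t by (simp add: w_def)
  have \<phi>w: "\<phi> (w j) = j" for j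
  proof (cases "j * c \<le> t + j")
    case True
    then show ?thesis using c0 by (simp add: \<phi>_def w_def)
  next
    case False
    then have "(t + j) div c < j" using c0 by (simp add: div_less_iff_less_mult)
    then show ?thesis using False by (simp add: \<phi>_def w_def)
  qed
  \<comment> \<open>A class stays within \<open>c\<close> positions of its first element, so it fits
    into a set of size \<open>c\<close>.\<close>
  have fibre: "w j \<le> x \<and> x < w j + c" if "\<phi> x = j" for x j
  proof -
    have le: "x div c \<le> j" "x - t \<le> j" and j: "x div c = j \<or> x - t = j"
      using that by (auto simp: \<phi>_def max_def split: if_splits)
    have "x < Suc (x div c) * c" using c0 by (metis div_less_iff_less_mult lessI)
    also have "\<dots> \<le> Suc j * c" using le(1) by (intro mult_le_mono1) simp
    finally have up: "x < j * c + c" by simp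
    have "x < t + j + c" using le(2) c0 by linarith
    moreover have "j * c \<le> x \<or> t + j \<le> x \<or> j = 0"
      using j by (metis add_diff_inverse_nat diff_is_0_eq' div_times_less_eq_dividend le_add_diff_inverse nat_le_linear)
    ultimately show ?thesis using up by (auto simp: w_def min_def)
  qed
  \<comment> \<open>Class \<open>j\<close> is padded to size \<open>c\<close> while avoiding the
    \<open>k\<close> points \<open>w i\<close> with \<open>i \<noteq> j\<close>; by
    \<open>k < m\<close> at least \<open>N - k > c\<close> candidates remain.\<close>
  have "\<exists>E. {x. x < N \<and> \<phi> x = j} \<subseteq> E \<and> E \<subseteq> {..<N} - w ` ({..k} - {j}) \<and> card E = c" if j: "j \<le> k" for j
  proof (rule exists_subset_between)
    have "card {x. x < N \<and> \<phi> x = j} \<le> card {w j..<w j + c}"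
      using fibre by (intro card_mono) auto
    then show "card {x. x < N \<and> \<phi> x = j} \<le> c" by simp
    have "card (w ` ({..k} - {j})) \<le> k" using j by (intro card_image_le[THEN order_trans]) auto
    then have "N - k \<le> N - card (w ` ({..k} - {j}))" by simp
    also have "\<dots> \<le> card ({..<N} - w ` ({..k} - {j}))"
      by (metis card_lessThan diff_card_le_card_Diff finite_Diff finite_atMost finite_imageI)
    finally show "c \<le> card ({..<N} - w ` ({..k} - {j}))" using km by (simp add: N_def)
    show "{x. x < N \<and> \<phi> x = j} \<subseteq> {..<N} - w ` ({..k} - {j})" using \<phi>w by auto
  qed auto
  then obtain E where E: "\<And>j. j \<le> k \<Longrightarrow> {x. x < N \<and> \<phi> x = j} \<subseteq> E j \<and> E j \<subseteq> {..<N} - w ` ({..k} - {j}) \<and> card (E j) = c"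
    by metis
  interpret coloured_complex d k m N \<phi> w E
  proof
    show "mono \<phi>" unfolding \<phi>_def by (intro monoI max.mono div_le_mono diff_le_mono)
    show "x \<in> E (\<phi> x)" if "x < N" for x using E[OF \<phi>k[OF that]] that by blast
    show "w i \<notin> E j" if "i \<le> k" "j \<le> k" "i \<noteq> j" for i j using E[OF that(2)] that by blast
  qed (use k m km sc E wN \<phi>w \<phi>k in \<open>auto simp: N_def\<close>)
  show ?thesis
  proof (rule that[OF finite_Y pure_Y strongly_connected_Y])
    show "card (\<Union>Y) = Suc d + c" unfolding Union_Y V_def using m by (simp add: N_def)
  qed (rule homology_Y)
qed

section \<open>From the ceilings to integer inequalities\<close>

theorem theorem3:
  fixes k d m :: nat
  assumes "1 \<le> k" and "k \<le> d"
    and "int d + 1 - \<lceil>(real d + 1) / (real k + 1)\<rceil> < int m" and "m \<le> d"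
  shows
    "(\<forall>X :: 'v::linorder set set.
        finite X \<and> pure_complex d X \<and> strongly_connected m X \<and>
        \<not> trivial_group (homology_group k X :: ('v set \<Rightarrow> 'g::ab_group_add) set monoid) \<longrightarrow>
        int d + 1 + \<lceil>real m / real k\<rceil> \<le> int (card (\<Union>X)))
   \<and> ((\<exists>g::'g. g \<noteq> 0) \<longrightarrow>
      (\<exists>Y :: nat set set.
        finite Y \<and> pure_complex d Y \<and> strongly_connected m Y \<and>
        \<not> trivial_group (homology_group k Y :: (nat set \<Rightarrow> 'g) set monoid) \<and>
        int (card (\<Union>Y)) = int d + 1 + \<lceil>real m / real k\<rceil>))"
proof -
  \<comment> \<open>Clearing the ceiling and the denominator gives
    \<open>(d + 1 - m) * (k + 1) < d + 1\<close>, that is,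
    \<open>k * (d + 1 - m) < m\<close>.\<close>
  have "int d + 1 - int m < \<lceil>(real d + 1) / (real k + 1)\<rceil>" using assms(3) by linarith
  then have "real_of_int (int d + 1 - int m) < (real d + 1) / (real k + 1)"
    by (simp only: less_ceiling_iff)
  then have "real (Suc d - m) < (real d + 1) / (real k + 1)" using assms(4) by (simp add: of_nat_diff)
  then have "real (Suc d - m) * (real k + 1) < real d + 1"
    by (simp add: pos_less_divide_eq)
  also have "real (Suc d - m) * (real k + 1) = real ((Suc d - m) * (k + 1))"
    by (simp only: of_nat_mult of_nat_add of_nat_1)
  also have "real d + 1 = real (Suc d)" by simp
  finally have "real ((Suc d - m) * (k + 1)) < real (Suc d)" .
  then have "(Suc d - m) * (k + 1) < Suc d" by (simp only: of_nat_less_iff)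
  moreover have "Suc d = m + (Suc d - m)" using assms(4) by simp
  moreover have "(Suc d - m) * (k + 1) = k * (Suc d - m) + (Suc d - m)" by simp
  ultimately have s: "k * (Suc d - m) < m" by linarith
  then have m1: "1 \<le> m" by linarith
  have ceil_le: "\<lceil>real m / real k\<rceil> \<le> int c \<longleftrightarrow> m \<le> k * c" for c
  proof -
    have "\<lceil>real m / real k\<rceil> \<le> int c \<longleftrightarrow> real m \<le> real c * real k"
      using assms(1) by (simp add: ceiling_le_iff pos_divide_le_eq)
    also have "\<dots> \<longleftrightarrow> m \<le> k * c" by (simp only: of_nat_mult[symmetric] of_nat_le_iff mult.commute)
    finally show ?thesis .
  qed
  show ?thesis
  proof (intro conjI allI impI)
    fix X :: "'v set set"
    assume X: "finite X \<and> pure_complex d X \<and> strongly_connected m X \<and>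
        \<not> trivial_group (homology_group k X :: ('v set \<Rightarrow> 'g) set monoid)"
    then have "m \<le> k * (card (\<Union>X) - Suc d)"
      using homology_trivial_if_few_vertices[of X d m k, where 'g = 'g] assms m1 by (meson not_le)
    \<comment> \<open>Otherwise the truncated difference is 0 and forces
      \<open>m = 0\<close>.\<close>
    moreover from this have "Suc d \<le> card (\<Union>X)" using m1 by (cases "Suc d \<le> card (\<Union>X)") auto
    ultimately show "int d + 1 + \<lceil>real m / real k\<rceil> \<le> int (card (\<Union>X))"
      using ceil_le[of "card (\<Union>X) - Suc d"] by (simp add: of_nat_diff)
  next
    assume "\<exists>g::'g. g \<noteq> 0"
    then obtain g :: 'g where g: "g \<noteq> 0" by blast
    define c where "c = nat \<lceil>real m / real k\<rceil>"
    have "0 \<le> \<lceil>real m / real k\<rceil>" by (rule order_trans[OF _ ceiling_mono[of 0]]) simp_all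
    then have c: "int c = \<lceil>real m / real k\<rceil>" by (simp add: c_def)
    then have "m \<le> k * c" by (metis ceil_le order_refl)
    then obtain Y :: "nat set set" where "finite Y" "pure_complex d Y" "strongly_connected m Y"
      "card (\<Union>Y) = Suc d + c"
      "\<not> trivial_group (homology_group k Y :: (nat set \<Rightarrow> 'g) set monoid)"
      using tight_example[OF assms(1,2,4) s, where 'g = 'g] g by metis
    then show "\<exists>Y :: nat set set.
        finite Y \<and> pure_complex d Y \<and> strongly_connected m Y \<and>
        \<not> trivial_group (homology_group k Y :: (nat set \<Rightarrow> 'g) set monoid) \<and>
        int (card (\<Union>Y)) = int d + 1 + \<lceil>real m / real k\<rceil>"
      using c by (intro exI[of _ Y]) simp
  qed
qed

end
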